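(* Let $E$ be a real uniformly smooth and 2-uniformly convex Banach space with dual $E^*$, and let $C$ be a nonempty closed convex subset of $E$. Let $A_1,\dots,A_M : C\to E^*$ be mappings and $\alpha>0$ a constant such that for each $i$: (V1) $A_i$ is $\alpha$-inverse strongly monotone; (V2) $VI(A_i,C)\neq\emptyset$; (V3) $\|A_iy\|\le\|A_iy-A_iu\|$ for all $y\in C$ and $u\in VI(A_i,C)$. Let $f_1,\dots,f_K: C\times C\to\mathbb{R}$ be bifunctions such that for each $k$: (A1) $f_k(x,x)=0$ for all $x\in C$; (A2) $f_k(x,y)+f_k(y,x)\le 0$ for all $x,y\in C$; (A3) $\limsup_{t\to0^+}f_k(tz+(1-t)x,y)\le f_k(x,y)$ for all $x,y,z\in C$; (A4) for each $x\in C$, $f_k(x,\cdot)$ is convex and lower semicontinuous. Let $S_1,\dots,S_N: C\to C$ be closed and quasi $\phi$-nonexpansive mappings. Suppose that $$F=\Big(\bigcap_{i=1}^M VI(A_i,C)\Big)\cap\Big(\bigcap_{j=1}^N F(S_j)\Big)\cap\Big(\bigcap_{k=1}^K EP(f_k)\Big)$$ is nonempty. Let $\{\alpha_n\},\{\lambda_n\},\{r_n\}$ be real sequences with $$0\le\alpha_n\le1,\quad \limsup_{n\to\infty}\alpha_n<1,\quad \lambda_n\in[a,b],\quad r_n\ge d$$ for some $a,b\in(0,\alpha c^2/2)$ and $d>0$, where $1/c$ is the 2-uniform convexity constant of $E$. Let $x_0\in C$, $C_0=C$, and for $n\ge0$ define $$\begin{aligned} &y_n^i=\Pi_C\big(J^{-1}(Jx_n-\lambda_nA_ix_n)\big),\quad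 i=1,\dots,M,\\ &i_n\in\arg\max\{\|y_n^i-x_n\|:1\le i\le M\},\quad \bar y_n=y_n^{i_n},\\ &z_n^j=J^{-1}\big(\alpha_nJx_n+(1-\alpha_n)JS_j\bar y_n\big),\quad j=1,\dots,N,\\ &j_n\in\arg\max\{\|z_n^j-x_n\|:1\le j\le N\},\quad \bar z_n=z_n^{j_n},\\ &u_n^k=T_{r_n}^k\bar z_n,\quad k=1,\dots,K,\\ &k_n\in\arg\max\{\|u_n^k-x_n\|:1\le k\le K\},\quad \bar u_n=u_n^{k_n},\\ &C_{n+1}=\{z\in C_n:\phi(z,\bar u_n)\le\phi(z,\bar z_n)\le\phi(z,x_n)\},\\ &x_{n+1}=\Pi_{C_{n+1}}x_0. \end{aligned}$$ Then $\{x_n\}$ converges strongly to $\Pi_Fx_0$.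
   Context: $J:E\to E^*$ is the normalized duality mapping, $\langle Jx,x\rangle=\|x\|^2=\|Jx\|^2$ (single-valued and bijective here). The 2-uniform convexity constant $1/c$ of $E$: $c$ is the best (largest) constant in $(0,1]$ such that $\|x-y\|\le\frac{2}{c^2}\|Jx-Jy\|$ for all $x,y\in E$. Lyapunov functional: $\phi(x,y)=\|x\|^2-2\langle x,Jy\rangle+\|y\|^2$ for $x,y\in E$. For a nonempty closed convex $D\subset E$, the generalized projection $\Pi_D:E\to D$ is $\Pi_D(x)=\arg\min_{y\in D}\phi(y,x)$ (the unique minimizer). For $A:C\to E^*$: $A$ is $\alpha$-inverse strongly monotone if $\langle Ax-Ay,x-y\rangle\ge\alpha\|Ax-Ay\|^2$ for all $x,y\in C$; $VI(A,C)=\{p^*\in C:\langle Ap^*,p-p^*\rangle\ge0\ \forall p\in C\}$. For $f:C\times C\to\mathbb{R}$: $EP(f)=\{\hat x\in C: f(\hat x,y)\ge0\ \forall y\in C\}$. For $r>0$ and $x\in E$, $T_r^kx$ denotes the unique $z\in C$ with $f_k(z,y)+\frac1r\langle y-z,Jz-Jx\rangle\ge0$ for all $y\in C$ (existence and uniqueness hold under (A1)-(A4)). For $T:C\to C$: $F(T)$ is the fixed point set. $T$ is closed if $x_n\in C$, $x_n\to x$ and $Tx_n\to y$ imply $Tx=y$. $T$ is quasi $\phi$-nonexpansive if $F(T)\ne\emptyset$ and $\phi(p,Tx)\le\phi(p,x)$ for all $p\in F(T)$, $x\in C$. Ties in the $\arg\max$ are broken arbitrarily. *)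

theory Defs
  imports "HOL-Analysis.Analysis"
begin

text \<open>
  \<open>E\<close> is a type \<open>'a\<close> of class \<open>banach\<close>; its dual is \<open>'a \<Rightarrow>\<^sub>L real\<close> with the operator norm.

  The two moduli take values in \<open>ennreal\<close>. The quantities under \<open>INF\<close> and \<open>SUP\<close> are nonnegative by the
  triangle inequality, so \<open>ennreal\<close> does not truncate them; the infimum and supremum over the empty
  set (which only occurs for the zero space) get their conventional values \<open>\<infinity>\<close> and \<open>0\<close>.
\<close>

definition modulus_of_convexity :: "'a::real_normed_vector itself \<Rightarrow> real \<Rightarrow> ennreal" where
  "modulus_of_convexity _ \<epsilon> =
     (INF (x, y) \<in> {(x::'a, y). norm x = 1 \<and> norm y = 1 \<and> norm (x - y) \<ge> \<epsilon>}.
        ennreal (1 - norm (x + y) / 2))"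

definition modulus_of_smoothness :: "'a::real_normed_vector itself \<Rightarrow> real \<Rightarrow> ennreal" where
  "modulus_of_smoothness _ t =
     (SUP (x, y) \<in> {(x::'a, y). norm x = 1 \<and> norm y = t}.
        ennreal ((norm (x + y) + norm (x - y)) / 2 - 1))"

definition two_uniformly_convex :: "'a::real_normed_vector itself \<Rightarrow> bool" where
  "two_uniformly_convex E \<longleftrightarrow>
     (\<exists>k>0. \<forall>\<epsilon>\<in>{0<..2}. modulus_of_convexity E \<epsilon> \<ge> ennreal (k * \<epsilon>\<^sup>2))"

definition uniformly_smooth :: "'a::real_normed_vector itself \<Rightarrow> bool" where
  "uniformly_smooth E \<longleftrightarrow> ((\<lambda>t. modulus_of_smoothness E t / ennreal t) \<longlongrightarrow> 0) (at_right 0)"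

definition J :: "'a::real_normed_vector \<Rightarrow> 'a \<Rightarrow>\<^sub>L real" where
  "J x = (THE j. blinfun_apply j x = (norm x)\<^sup>2 \<and> (norm j)\<^sup>2 = (norm x)\<^sup>2)"

abbreviation J_inv :: "('a::real_normed_vector \<Rightarrow>\<^sub>L real) \<Rightarrow> 'a" where
  "J_inv \<equiv> inv J"

text \<open>This is \<open>c\<close>; the 2-uniform convexity constant of the space is \<open>1/c\<close>.\<close>

definition two_uniform_convexity_c :: "'a::real_normed_vector itself \<Rightarrow> real" where
  "two_uniform_convexity_c _ =
     (GREATEST c. 0 < c \<and> c \<le> 1 \<and> (\<forall>x y::'a. norm (x - y) \<le> 2 / c\<^sup>2 * norm (J x - J y)))"

definition lyapunov :: "'a::real_normed_vector \<Rightarrow> 'a \<Rightarrow> real" (\<open>\<phi>\<close>) where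
  "\<phi> x y = (norm x)\<^sup>2 - 2 * blinfun_apply (J y) x + (norm y)\<^sup>2"

definition gen_proj :: "'a::real_normed_vector set \<Rightarrow> 'a \<Rightarrow> 'a" (\<open>\<Pi>\<close>) where
  "\<Pi> D x = arg_min_on (\<lambda>y. \<phi> y x) D"

text \<open>Maps and bifunctions on \<open>C\<close> are total functions; only their values on \<open>C\<close> are used.\<close>

definition inverse_strongly_monotone ::
    "real \<Rightarrow> 'a::real_normed_vector set \<Rightarrow> ('a \<Rightarrow> 'a \<Rightarrow>\<^sub>L real) \<Rightarrow> bool" where
  "inverse_strongly_monotone \<alpha> C A \<longleftrightarrow>
     (\<forall>x\<in>C. \<forall>y\<in>C. blinfun_apply (A x - A y) (x - y) \<ge> \<alpha> * (norm (A x - A y))\<^sup>2)"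

definition VI :: "('a::real_normed_vector \<Rightarrow> 'a \<Rightarrow>\<^sub>L real) \<Rightarrow> 'a set \<Rightarrow> 'a set" where
  "VI A C = {p \<in> C. \<forall>q\<in>C. blinfun_apply (A p) (q - p) \<ge> 0}"

definition EP :: "'a set \<Rightarrow> ('a \<Rightarrow> 'a \<Rightarrow> real) \<Rightarrow> 'a set" where
  "EP C f = {x \<in> C. \<forall>y\<in>C. f x y \<ge> 0}"

definition Fix :: "'a set \<Rightarrow> ('a \<Rightarrow> 'a) \<Rightarrow> 'a set" where
  "Fix C T = {x \<in> C. T x = x}"

definition lsc_on :: "'a::topological_space set \<Rightarrow> ('a \<Rightarrow> real) \<Rightarrow> bool" where
  "lsc_on C g \<longleftrightarrow> (\<forall>x\<in>C. ereal (g x) \<le> Liminf (at x within C) (\<lambda>y. ereal (g y)))"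

definition resolvent ::
    "'a::real_normed_vector set \<Rightarrow> ('a \<Rightarrow> 'a \<Rightarrow> real) \<Rightarrow> real \<Rightarrow> 'a \<Rightarrow> 'a" where
  "resolvent C f r x =
     (THE z. z \<in> C \<and> (\<forall>y\<in>C. f z y + 1 / r * blinfun_apply (J z - J x) (y - z) \<ge> 0))"

definition closed_mapping :: "'a::topological_space set \<Rightarrow> ('a \<Rightarrow> 'a) \<Rightarrow> bool" where
  "closed_mapping C T \<longleftrightarrow>
     (\<forall>u x y. (\<forall>n::nat. u n \<in> C) \<longrightarrow> u \<longlonglongrightarrow> x \<longrightarrow> (\<lambda>n. T (u n)) \<longlonglongrightarrow> y \<longrightarrow> T x = y)"

definition quasi_phi_nonexpansive :: "'a::real_normed_vector set \<Rightarrow> ('a \<Rightarrow> 'a) \<Rightarrow> bool" where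
  "quasi_phi_nonexpansive C T \<longleftrightarrow>
     Fix C T \<noteq> {} \<and> (\<forall>p\<in>Fix C T. \<forall>x\<in>C. \<phi> p (T x) \<le> \<phi> p x)"

end

theory Submission
  imports Defs
begin

text \<open>
  For \<open>q \<in> F\<close> each substep decreases \<open>\<phi> q\<close>: the resolvents and the \<open>S j\<close> do not increase it, and
  the projected gradient step gains a positive multiple of \<open>(norm (A i (x n)))\<^sup>2\<close>, since \<open>J_inv\<close> is
  \<open>2 / c\<^sup>2\<close>-Lipschitz and \<open>lam n \<le> b < \<alpha> * c\<^sup>2 / 2\<close>. Hence \<open>F \<subseteq> Cs n\<close>. The values
  \<open>\<phi> (x n) (x 0)\<close> increase and are bounded, and \<open>\<phi> (x n) (x m) \<le> \<phi> (x n) (x 0) - \<phi> (x m) (x 0)\<close> for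
  \<open>m \<le> n\<close>, so \<open>x\<close> converges to some \<open>p\<close>. As \<open>x (Suc n)\<close> lies in \<open>Cs (Suc n)\<close>, also \<open>zbar\<close> and \<open>ubar\<close>
  tend to \<open>p\<close>, and then, by maximality of the chosen indices, all \<open>z n j\<close>, \<open>u n k\<close> and \<open>y n i\<close>; passing
  to the limit in the defining inequalities gives \<open>p \<in> F\<close>. Finally
  \<open>\<phi> q (x n) + \<phi> (x n) (x 0) \<le> \<phi> q (x 0)\<close> becomes \<open>\<phi> q p + \<phi> p (x 0) \<le> \<phi> q (x 0)\<close>, which makes \<open>p\<close> the
  unique minimizer over \<open>F\<close>, without using that \<open>F\<close> is closed and convex.

  Surjectivity of \<open>J\<close> and existence of generalized projections are the case \<open>f = 0\<close> of the existence of
  resolvents.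
\<close>

section \<open>The duality mapping of a uniformly smooth space\<close>

locale smooth_space =
  fixes E :: "'a::real_normed_vector itself"
  assumes smooth: "uniformly_smooth E"
begin

text \<open>Unwinds the limit of the modulus quotient into an epsilon-delta bound with one
  \<open>\<delta>\<close> for the whole unit sphere. The limit controls \<open>t > 0\<close> only,
  so \<open>h = 0\<close> is checked separately.\<close>

lemma smooth_unit:
  assumes "\<epsilon> > 0"
  obtains \<delta> where "\<delta> > 0"
    and "\<And>x h :: 'a. norm x = 1 \<Longrightarrow> norm h < \<delta> \<Longrightarrow> norm (x + h) + norm (x - h) \<le> 2 + \<epsilon> * norm h"
proof -
  have "\<forall>\<^sub>F t in at_right 0. modulus_of_smoothness E t / ennreal t < ennreal (\<epsilon> / 2)"
    using smooth assms unfolding uniformly_smooth_def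
    by (intro order_tendstoD(2)) auto
  then obtain \<delta> where \<delta>: "\<delta> > 0"
    "\<And>t. 0 < t \<Longrightarrow> t < \<delta> \<Longrightarrow> modulus_of_smoothness E t / ennreal t < ennreal (\<epsilon> / 2)"
    unfolding eventually_at_right_field by auto
  have "norm (x + h) + norm (x - h) \<le> 2 + \<epsilon> * norm h" if x: "norm x = 1" and h: "norm h < \<delta>" for x h :: 'a
  proof (cases "h = 0")
    case False
    define t where "t = norm h"
    have t: "0 < t" "t < \<delta>" using False h by (auto simp: t_def)
    have "modulus_of_smoothness E t \<le> ennreal (\<epsilon> / 2) * ennreal t"
      using \<delta>(2)[OF t] t by (simp add: divide_less_ennreal less_imp_le)
    also have "\<dots> = ennreal (\<epsilon> / 2 * t)"
      using assms t by (simp flip: ennreal_mult)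
    finally have "modulus_of_smoothness E t \<le> ennreal (\<epsilon> / 2 * t)" .
    moreover have "ennreal ((norm (x + h) + norm (x - h)) / 2 - 1) \<le> modulus_of_smoothness E t"
      unfolding modulus_of_smoothness_def
      by (rule SUP_upper2[of "(x, h)"]) (use x in \<open>auto simp: t_def\<close>)
    ultimately have "ennreal ((norm (x + h) + norm (x - h)) / 2 - 1) \<le> ennreal (\<epsilon> / 2 * t)"
      by (rule order_trans[rotated])
    hence "(norm (x + h) + norm (x - h)) / 2 - 1 \<le> \<epsilon> / 2 * t"
      using assms t by (subst (asm) ennreal_le_iff) auto
    thus ?thesis by (simp add: t_def field_simps)
  qed (use x in simp)
  with \<delta>(1) show ?thesis using that by blast
qed

text \<open>Homogeneity: dividing \<open>x\<close> and \<open>h\<close> by \<open>norm x\<close>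
  reduces to the unit sphere and scales the radius to \<open>\<delta> * norm x\<close>.\<close>

lemma smooth_at:
  fixes x :: 'a
  assumes "\<epsilon> > 0" "x \<noteq> 0"
  obtains \<delta> where "\<delta> > 0"
    and "\<And>h. norm h < \<delta> \<Longrightarrow> norm (x + h) + norm (x - h) \<le> 2 * norm x + \<epsilon> * norm h"
proof -
  obtain \<delta> where \<delta>: "\<delta> > 0"
    "\<And>x h :: 'a. norm x = 1 \<Longrightarrow> norm h < \<delta> \<Longrightarrow> norm (x + h) + norm (x - h) \<le> 2 + \<epsilon> * norm h"
    using smooth_unit[OF assms(1)] by metis
  have "norm (x + h) + norm (x - h) \<le> 2 * norm x + \<epsilon> * norm h" if h: "norm h < \<delta> * norm x" for h
  proof -
    define s where "s = norm x"
    have s: "s > 0" using assms by (simp add: s_def)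
    have eq: "norm (x /\<^sub>R s + h /\<^sub>R s) = norm (x + h) / s" "norm (x /\<^sub>R s - h /\<^sub>R s) = norm (x - h) / s"
      using s by (simp_all add: divide_inverse mult.commute flip: scaleR_add_right scaleR_diff_right)
    have "norm (x /\<^sub>R s + h /\<^sub>R s) + norm (x /\<^sub>R s - h /\<^sub>R s) \<le> 2 + \<epsilon> * norm (h /\<^sub>R s)"
      by (rule \<delta>(2)) (use h s assms in \<open>auto simp: s_def field_simps\<close>)
    hence "(norm (x + h) + norm (x - h)) / s \<le> (2 * s + \<epsilon> * norm h) / s"
      using s unfolding eq by (simp add: field_simps)
    thus ?thesis using s by (simp add: divide_le_cancel s_def)
  qed
  moreover have "\<delta> * norm x > 0" using \<delta> assms by simp
  ultimately show ?thesis using that by blast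
qed

text \<open>Adding \<open>l (x + h) \<le> norm (x + h)\<close> and
  \<open>m (x - h) \<le> norm (x - h)\<close> lets smoothness bound \<open>(l - m) h\<close> on a
  small sphere; passing from \<open>m x\<close> to \<open>m y\<close> costs
  \<open>2 * norm (x - y)\<close>. With \<open>y = x\<close> this gives uniqueness of norming
  functionals, with \<open>y\<close> tending to \<open>x\<close> continuity of
  \<open>J\<close>.\<close>

lemma norming_functional_stable:
  fixes x :: 'a
  assumes "\<epsilon> > 0" "x \<noteq> 0"
  obtains \<eta> where "\<eta> > 0"
    and "\<And>y l m. norm (l :: 'a \<Rightarrow>\<^sub>L real) \<le> 1 \<Longrightarrow> l x = norm x \<Longrightarrow> norm (m :: 'a \<Rightarrow>\<^sub>L real) \<le> 1 \<Longrightarrow> m y = norm y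
          \<Longrightarrow> norm (l - m) \<le> \<epsilon> + 2 * norm (x - y) / \<eta>"
proof -
  obtain \<delta> where \<delta>: "\<delta> > 0"
    "\<And>h. norm h < \<delta> \<Longrightarrow> norm (x + h) + norm (x - h) \<le> 2 * norm x + \<epsilon> * norm h"
    using smooth_at[OF assms] by metis
  define \<eta> where "\<eta> = \<delta> / 2"
  have \<eta>: "0 < \<eta>" "\<eta> < \<delta>" using \<delta> by (auto simp: \<eta>_def)
  have "norm (l - m) \<le> \<epsilon> + 2 * norm (x - y) / \<eta>"
    if l: "norm (l :: 'a \<Rightarrow>\<^sub>L real) \<le> 1" "l x = norm x" and m: "norm (m :: 'a \<Rightarrow>\<^sub>L real) \<le> 1" "m y = norm y" for y l m
  proof (rule norm_blinfun_bound)
    have le: "blinfun_apply k v \<le> norm v" if "norm (k :: 'a \<Rightarrow>\<^sub>L real) \<le> 1" for k v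
    proof -
      have "blinfun_apply k v \<le> norm k * norm v"
        using norm_blinfun[of k v] by auto
      also have "\<dots> \<le> 1 * norm v" using that by (intro mult_right_mono) auto
      finally show ?thesis by simp
    qed
    have key: "(l - m) h \<le> \<epsilon> * norm h + 2 * norm (x - y)" if h: "norm h = \<eta>" for h
    proof -
      have "l (x + h) \<le> norm (x + h)" "m (x - h) \<le> norm (x - h)" "m (y - x) \<le> norm (y - x)"
        using l m le by blast+
      moreover have "norm y \<ge> norm x - norm (x - y)"
        using norm_triangle_ineq3[of x y] by linarith
      moreover have "norm (x + h) + norm (x - h) \<le> 2 * norm x + \<epsilon> * norm h"
        using \<delta>(2)[of h] h \<eta> by simp
      ultimately show ?thesis using l m
        by (simp add: blinfun.add_right blinfun.diff_right blinfun.diff_left norm_minus_commute)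
    qed
    show "norm ((l - m) v) \<le> (\<epsilon> + 2 * norm (x - y) / \<eta>) * norm v" for v
    proof (cases "v = 0")
      case False
      \<comment> \<open>Both \<open>k *\<^sub>R v\<close> and its negative lie on the sphere where
        \<open>key\<close> applies, which bounds the absolute value.\<close>
      define k where "k = \<eta> / norm v"
      have k: "k > 0" using False \<eta> by (simp add: k_def)
      have nk: "norm (k *\<^sub>R v) = \<eta>" "norm (- (k *\<^sub>R v)) = \<eta>" using False \<eta> by (simp_all add: k_def)
      have "\<bar>k * (l - m) v\<bar> \<le> \<epsilon> * \<eta> + 2 * norm (x - y)"
        using key[OF nk(1)] key[OF nk(2)] nk
        by (simp add: blinfun.scaleR_right blinfun.minus_right abs_le_iff)
      hence "\<bar>(l - m) v\<bar> \<le> (\<epsilon> * \<eta> + 2 * norm (x - y)) / k"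
        using k by (simp add: abs_mult field_simps)
      also have "\<dots> = (\<epsilon> + 2 * norm (x - y) / \<eta>) * norm v"
        using \<eta> False by (simp add: k_def field_simps)
      finally show ?thesis by simp
    qed simp
    show "0 \<le> \<epsilon> + 2 * norm (x - y) / \<eta>" using assms \<eta> by simp
  qed
  with \<eta>(1) show ?thesis using that by blast
qed

text \<open>The functional is the directional derivative of the norm at \<open>x\<close>. It is sublinear because the
  norm is convex, and smoothness makes it odd; so the Hahn--Banach theorem is not needed.\<close>

lemma norming_functional_exists:
  fixes x :: 'a
  assumes "x \<noteq> 0"
  obtains l :: "'a \<Rightarrow>\<^sub>L real" where "norm l \<le> 1" "l x = norm x"
proof -
  define q where "q h t = (norm (x + t *\<^sub>R h) - norm x) / t" for h and t :: real
  define p where "p h = (INF t\<in>{0<..}. q h t)" for h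
  have q_lower: "- norm h \<le> q h t" if "t > 0" for h t
    using norm_diff_ineq[of x "t *\<^sub>R h"] that by (simp add: q_def field_simps)
  have q_upper: "q h t \<le> norm h" if "t > 0" for h t
    using norm_triangle_ineq[of x "t *\<^sub>R h"] that by (simp add: q_def field_simps)
  have bdd: "bdd_below (q h ` {0<..})" for h
    by (rule bdd_belowI2[of _ "- norm h"]) (use q_lower in auto)
  have p_le: "p h \<le> q h t" if "t > 0" for h t
    unfolding p_def using that by (intro cINF_lower bdd) auto
  have p_ge: "m \<le> p h" if "\<And>t. t > 0 \<Longrightarrow> m \<le> q h t" for h m
    unfolding p_def using that by (intro cINF_greatest) auto
  \<comment> \<open>By convexity of the norm the difference quotients increase with the step, so
    their infimum \<open>p h\<close> is the one-sided derivative.\<close>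
  have q_mono: "q h s \<le> q h t" if "0 < s" "s \<le> t" for h s t
  proof -
    have "x + s *\<^sub>R h = (s / t) *\<^sub>R (x + t *\<^sub>R h) + (1 - s / t) *\<^sub>R x"
      using that by (simp add: algebra_simps)
    hence "norm (x + s *\<^sub>R h) \<le> (s / t) * norm (x + t *\<^sub>R h) + (1 - s / t) * norm x"
      using that norm_triangle_ineq[of "(s / t) *\<^sub>R (x + t *\<^sub>R h)" "(1 - s / t) *\<^sub>R x"] by simp
    thus ?thesis using that by (simp add: q_def field_simps)
  qed
  have q_sub: "q (h + k) t \<le> q h (2 * t) + q k (2 * t)" if "t > 0" for h k t
  proof -
    have "x + t *\<^sub>R (h + k) = (1 / 2) *\<^sub>R (x + (2 * t) *\<^sub>R h) + (1 / 2) *\<^sub>R (x + (2 * t) *\<^sub>R k)"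
      by (simp add: algebra_simps flip: scaleR_add_left)
    hence "norm (x + t *\<^sub>R (h + k)) \<le> 1 / 2 * norm (x + (2 * t) *\<^sub>R h) + 1 / 2 * norm (x + (2 * t) *\<^sub>R k)"
      using norm_triangle_ineq[of "(1 / 2) *\<^sub>R (x + (2 * t) *\<^sub>R h)" "(1 / 2) *\<^sub>R (x + (2 * t) *\<^sub>R k)"] by simp
    hence "(2 * norm (x + t *\<^sub>R (h + k)) - 2 * norm x) / (2 * t)
        \<le> (norm (x + (2 * t) *\<^sub>R h) + norm (x + (2 * t) *\<^sub>R k) - 2 * norm x) / (2 * t)"
      using that by (intro divide_right_mono) auto
    thus ?thesis using that by (simp add: q_def add_divide_distrib diff_divide_distrib)
  qed
  have p_sub: "p (h + k) \<le> p h + p k" for h k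
  proof -
    have "p (h + k) - p k \<le> p h"
    proof (rule p_ge)
      fix t :: real assume t: "t > 0"
      have "p (h + k) - q h t \<le> p k"
      proof (rule p_ge)
        fix s :: real assume s: "s > 0"
        \<comment> \<open>The step \<open>2 * w\<close> is below both \<open>s\<close> and
          \<open>t\<close>, so by monotonicity it serves both quotients.\<close>
        define w where "w = min s t / 2"
        have w: "w > 0" using s t by (simp add: w_def)
        have "p (h + k) \<le> q h (2 * w) + q k (2 * w)"
          by (rule order_trans[OF p_le[OF w] q_sub[OF w]])
        also have "\<dots> \<le> q h t + q k s"
          by (intro add_mono q_mono) (use s t in \<open>auto simp: w_def\<close>)
        finally show "p (h + k) - q h t \<le> q k s" by simp
      qed
      thus "p (h + k) - p k \<le> q h t" by simp
    qed
    thus ?thesis by simp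
  qed
  have "p 0 \<le> q 0 1" "0 \<le> p 0" by (rule p_le p_ge; simp add: q_def)+
  hence p0: "p 0 = 0" by (simp add: q_def)
  have p_minus: "p (- h) = - p h" for h
  proof -
    have "p h + p (- h) \<le> \<epsilon>" if "\<epsilon> > 0" for \<epsilon>
    proof (cases "h = 0")
      case True
      thus ?thesis using p0 that by simp
    next
      case False
      \<comment> \<open>Chosen so that smoothness bounds the sum of the two opposite quotients by
        \<open>e * norm h = \<epsilon>\<close>.\<close>
      define e where "e = \<epsilon> / norm h"
      have e: "e > 0" using False that by (simp add: e_def)
      obtain \<delta> where \<delta>: "\<delta> > 0"
        "\<And>h. norm h < \<delta> \<Longrightarrow> norm (x + h) + norm (x - h) \<le> 2 * norm x + e * norm h"
        using smooth_at[OF e assms] by metis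
      define t where "t = \<delta> / (2 * norm h)"
      have t: "t > 0" "norm (t *\<^sub>R h) < \<delta>" using \<delta> False by (simp_all add: t_def)
      have "p h + p (- h) \<le> q h t + q (- h) t"
        by (intro add_mono p_le t)
      also have "\<dots> = (norm (x + t *\<^sub>R h) + norm (x - t *\<^sub>R h) - 2 * norm x) / t"
        by (simp add: q_def add_divide_distrib diff_divide_distrib)
      also have "\<dots> \<le> \<epsilon>"
        using \<delta>(2)[OF t(2)] t False by (simp add: e_def field_simps)
      finally show ?thesis .
    qed
    hence "p h + p (- h) \<le> 0" by (meson dense_ge)
    moreover have "0 \<le> p h + p (- h)" using p_sub[of h "- h"] p0 by simp
    ultimately show ?thesis by simp
  qed
  \<comment> \<open>Subadditivity at \<open>h + k\<close> and \<open>- k\<close>, with oddness, is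
    the reverse inequality.\<close>
  have add: "p (h + k) = p h + p k" for h k
    using p_sub[of h k] p_sub[of "h + k" "- k"] p_minus[of k] by simp
  have scale_pos: "p (r *\<^sub>R h) = r * p h" if r: "r > 0" for r h
  proof -
    have q_scale: "q (r *\<^sub>R h) t = r * q h (r * t)" if "r > 0" for r t h
      using that by (simp add: q_def mult.commute)
    have le: "r * p h \<le> p (r *\<^sub>R h)" if r: "r > 0" for r h
      by (rule p_ge) (use r in \<open>simp add: q_scale p_le\<close>)
    have "p (r *\<^sub>R h) \<le> r * p h"
      using le[of "inverse r" "r *\<^sub>R h"] r by (simp add: field_simps)
    with le[OF r] show ?thesis by (rule order_antisym[rotated])
  qed
  have scale: "p (r *\<^sub>R h) = r * p h" for r h
  proof (cases r "0 :: real" rule: linorder_cases)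
    case less
    thus ?thesis using scale_pos[of "- r" h] p_minus[of "r *\<^sub>R h"] by simp
  qed (use scale_pos p0 in auto)
  have le: "p h \<le> norm h" for h using p_le[of 1 h] q_upper[of 1 h] by simp
  have bound: "\<bar>p h\<bar> \<le> norm h" for h using le[of h] le[of "- h"] p_minus[of h] by simp
  have lin: "bounded_linear p"
    by (rule bounded_linear_intro[of _ 1]) (use add scale bound in auto)
  have px: "p x = norm x"
  proof (rule antisym[OF le p_ge])
    fix t :: real assume t: "t > 0"
    have "norm (x + t *\<^sub>R x) = (1 + t) * norm x"
      using t norm_scaleR[of "1 + t" x] by (simp add: scaleR_add_left)
    thus "norm x \<le> q x t" using t by (simp add: q_def field_simps)
  qed
  show ?thesis
  proof
    show "norm (Blinfun p) \<le> 1"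
      by (rule norm_blinfun_bound) (use bound lin in \<open>auto simp: bounded_linear_Blinfun_apply\<close>)
    show "Blinfun p x = norm x" using lin px by (simp add: bounded_linear_Blinfun_apply)
  qed
qed

text \<open>As \<open>J\<close> is a definite description, existence and uniqueness come first. Away
  from \<open>0\<close> the candidates are \<open>norm x\<close> times a norming functional, and two
  norming functionals agree by \<open>norming_functional_stable\<close> with \<open>y = x\<close>
  and arbitrary \<open>\<epsilon>\<close>.\<close>

lemma J_props: "J x x = (norm x)\<^sup>2" "norm (J (x :: 'a)) = norm x"
proof -
  have "\<exists>!j :: 'a \<Rightarrow>\<^sub>L real. blinfun_apply j x = (norm x)\<^sup>2 \<and> (norm j)\<^sup>2 = (norm x)\<^sup>2"
  proof (cases "x = 0")
    case True
    thus ?thesis by (auto intro!: ex1I[of _ 0])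
  next
    case False
    define s where "s = norm x"
    have s: "s > 0" using False by (simp add: s_def)
    obtain l :: "'a \<Rightarrow>\<^sub>L real" where l: "norm l \<le> 1" "l x = norm x"
      using norming_functional_exists[OF False] by metis
    have "norm l \<ge> 1" using norm_blinfun[of l x] l s by (simp add: s_def)
    with l have nl: "norm l = 1" by simp
    show ?thesis
    proof (rule ex1I)
      show "(s *\<^sub>R l) x = (norm x)\<^sup>2 \<and> (norm (s *\<^sub>R l))\<^sup>2 = (norm x)\<^sup>2"
        using nl l s by (simp add: s_def blinfun.scaleR_left power2_eq_square)
    next
      fix j :: "'a \<Rightarrow>\<^sub>L real" assume j: "blinfun_apply j x = (norm x)\<^sup>2 \<and> (norm j)\<^sup>2 = (norm x)\<^sup>2"
      define m where "m = j /\<^sub>R s"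
      have nj: "norm j = s" using j by (simp add: s_def)
      have m: "norm m \<le> 1" "m x = norm x"
        using nj j s by (simp_all add: m_def blinfun.scaleR_left s_def power2_eq_square)
      have "norm (l - m) \<le> \<epsilon>" if "\<epsilon> > 0" for \<epsilon>
      proof (rule norming_functional_stable[OF that False])
        fix \<eta> :: real
        assume "\<And>y l m. norm (l :: 'a \<Rightarrow>\<^sub>L real) \<le> 1 \<Longrightarrow> l x = norm x \<Longrightarrow>
          norm (m :: 'a \<Rightarrow>\<^sub>L real) \<le> 1 \<Longrightarrow> m y = norm y \<Longrightarrow> norm (l - m) \<le> \<epsilon> + 2 * norm (x - y) / \<eta>"
        from this[OF l m] show ?thesis by simp
      qed
      hence "norm (l - m) \<le> 0" by (meson dense_ge)
      thus "j = s *\<^sub>R l" using s by (simp add: m_def)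
    qed
  qed
  from theI'[OF this] show "J x x = (norm x)\<^sup>2" "norm (J x) = norm x"
    by (auto simp: J_def)
qed

lemma J_le: "J y x \<le> norm x * norm (y :: 'a)"
  using norm_blinfun[of "J y" x] by (simp add: J_props mult.commute)

text \<open>\<open>J y\<close> is a subgradient of half the squared norm at \<open>y\<close>,
  because \<open>norm x * norm y\<close> is at most the mean of the squares.\<close>

lemma J_subgradient: "J y (x - y) \<le> (norm x)\<^sup>2 / 2 - (norm (y :: 'a))\<^sup>2 / 2"
proof -
  have "J y (x - y) \<le> norm x * norm y - (norm y)\<^sup>2"
    using J_le[of y x] by (simp add: blinfun.diff_right J_props)
  moreover have "0 \<le> (norm x - norm y)\<^sup>2" by simp
  ultimately show ?thesis by (simp add: power2_eq_square algebra_simps)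
qed

lemma J_0 [simp]: "J (0 :: 'a) = 0"
  using J_props(2)[of 0] by simp

text \<open>At \<open>0\<close> it suffices that \<open>J\<close> preserves norms. Elsewhere the
  normalized functional \<open>u\<close> is norming, hence stable.\<close>

lemma isCont_J: "isCont J (x :: 'a)"
proof (cases "x = 0")
  case True
  have "((\<lambda>y :: 'a. norm (J y)) \<longlongrightarrow> 0) (at 0)"
    unfolding J_props by (rule tendsto_norm_zero) (rule tendsto_ident_at)
  thus ?thesis using True by (simp add: isCont_def tendsto_norm_zero_cancel)
next
  case False
  define u where "u y = J y /\<^sub>R norm y" for y :: 'a
  have u: "norm (u y) \<le> 1" "u y y = norm y" for y
    by (cases "y = 0"; simp add: u_def blinfun.scaleR_left J_props power2_eq_square)
       (cases "y = 0"; simp add: u_def blinfun.scaleR_left J_props power2_eq_square)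
  have "(u \<longlongrightarrow> u x) (at x)"
  proof (rule tendstoI)
    fix \<epsilon> :: real assume \<epsilon>: "\<epsilon> > 0"
    then obtain \<eta> where \<eta>: "\<eta> > 0" "\<And>y l m. norm (l :: 'a \<Rightarrow>\<^sub>L real) \<le> 1 \<Longrightarrow> l x = norm x \<Longrightarrow>
         norm (m :: 'a \<Rightarrow>\<^sub>L real) \<le> 1 \<Longrightarrow> m y = norm y \<Longrightarrow> norm (l - m) \<le> \<epsilon> / 2 + 2 * norm (x - y) / \<eta>"
      using norming_functional_stable[of "\<epsilon> / 2", OF _ False] by (metis half_gt_zero)
    have "\<forall>\<^sub>F y in at x. dist y x < \<epsilon> * \<eta> / 4"
      using \<epsilon> \<eta> by (intro tendstoD[OF tendsto_ident_at]) simp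
    thus "\<forall>\<^sub>F y in at x. dist (u y) (u x) < \<epsilon>"
    proof eventually_elim
      case (elim y)
      have "norm (u x - u y) \<le> \<epsilon> / 2 + 2 * norm (x - y) / \<eta>"
        by (rule \<eta>(2)) (use u in auto)
      also have "\<dots> < \<epsilon> / 2 + \<epsilon> / 2"
        using elim \<eta>(1) by (simp add: dist_norm norm_minus_commute field_simps)
      finally show ?case by (simp add: dist_norm norm_minus_commute)
    qed
  qed
  hence "((\<lambda>y. norm y *\<^sub>R u y) \<longlongrightarrow> norm x *\<^sub>R u x) (at x)"
    by (intro tendsto_intros)
  moreover have "norm y *\<^sub>R u y = J y" for y by (cases "y = 0") (simp_all add: u_def)
  ultimately show ?thesis by (simp add: isCont_def)
qed

lemma tendsto_J [tendsto_intros]: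
  "(g \<longlongrightarrow> l) G \<Longrightarrow> ((\<lambda>n. J (g n)) \<longlongrightarrow> J (l :: 'a)) G"
  by (rule isCont_tendsto_compose[OF isCont_J])

text \<open>Law of cosines for \<open>\<phi>\<close>: a variational inequality at \<open>z\<close>
  fixes the sign of the last term and thereby compares values of \<open>\<phi>\<close>.\<close>

lemma phi_three_point: "\<phi> q x = \<phi> q z + \<phi> z x + 2 * (J z - J x) (q - (z :: 'a))"
  by (simp add: lyapunov_def blinfun.diff_left blinfun.diff_right J_props algebra_simps)

lemma phi_self [simp]: "\<phi> x (x :: 'a) = 0"
  by (simp add: lyapunov_def J_props)

lemma phi_nonneg: "\<phi> x (y :: 'a) \<ge> 0"
  using J_subgradient[of y x] by (simp add: lyapunov_def blinfun.diff_right J_props)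

lemma phi_add_swap: "\<phi> x y + \<phi> y x = 2 * (J x - J y) (x - (y :: 'a))"
  by (simp add: lyapunov_def blinfun.diff_left blinfun.diff_right J_props algebra_simps)

lemma tendsto_phi [tendsto_intros]:
  "(g \<longlongrightarrow> l) G \<Longrightarrow> (h \<longlongrightarrow> m) G \<Longrightarrow> ((\<lambda>n. \<phi> (g n) (h n)) \<longlongrightarrow> \<phi> (l :: 'a) m) G"
  unfolding lyapunov_def by (intro tendsto_intros)

end

section \<open>2-uniform convexity\<close>

text \<open>The midpoint gains both the radial part \<open>(1 - t)\<^sup>2 / 4\<close> and, by convexity of the sphere, the
  angular part \<open>t * (k * e\<^sup>2) / 2\<close> with \<open>e = norm (x - v)\<close>; they control
  \<open>norm (x - t *\<^sub>R v) \<le> t * e + (1 - t)\<close>.\<close>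

lemma midpoint_unit:
  fixes x v :: "'a::real_normed_vector"
  assumes conv: "norm (x + v) / 2 \<le> 1 - k * (norm (x - v))\<^sup>2"
    and x: "norm x = 1" and t: "0 \<le> t" "t \<le> 1" and \<kappa>: "0 \<le> \<kappa>" "\<kappa> \<le> 1 / 8" "\<kappa> \<le> k / 4"
  shows "(norm (x + t *\<^sub>R v) / 2)\<^sup>2 + \<kappa> * (norm (x - t *\<^sub>R v))\<^sup>2 \<le> 1 / 2 + t\<^sup>2 / 2"
proof -
  define e where "e = norm (x - v)"
  define q where "q = t * (k * e\<^sup>2)"
  define m where "m = (1 + t) / 2"
  have k: "k \<ge> 0" using \<kappa> by simp
  have "k * e\<^sup>2 \<le> 1" using conv norm_ge_zero[of "x + v"] unfolding e_def by linarith
  \<comment> \<open>\<open>q \<le> t\<close> keeps \<open>2 * m - q\<close> above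
    \<open>1 / 2\<close>, so after squaring a gain of \<open>q / 2\<close> remains.\<close>
  hence q: "0 \<le> q" "q \<le> t" using k t by (auto simp: q_def mult_left_le)
  have "norm (x + t *\<^sub>R v) \<le> t * norm (x + v) + (1 - t)"
  proof -
    have "x + t *\<^sub>R v = t *\<^sub>R (x + v) + (1 - t) *\<^sub>R x" by (simp add: algebra_simps)
    thus ?thesis
      using norm_triangle_ineq[of "t *\<^sub>R (x + v)" "(1 - t) *\<^sub>R x"] x t by simp
  qed
  also have "t * norm (x + v) \<le> t * (2 - 2 * (k * e\<^sup>2))"
    using conv t unfolding e_def by (intro mult_left_mono) auto
  finally have "norm (x + t *\<^sub>R v) / 2 \<le> m - q"
    by (simp add: m_def q_def algebra_simps)
  hence "(norm (x + t *\<^sub>R v) / 2)\<^sup>2 \<le> (m - q)\<^sup>2"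
    by (intro power_mono) auto
  also have "\<dots> = m\<^sup>2 - q * (2 * m - q)" by (simp add: power2_eq_square algebra_simps)
  also have "\<dots> \<le> m\<^sup>2 - q * (1 / 2)"
    using q t by (intro diff_left_mono mult_left_mono) (auto simp: m_def field_simps)
  finally have 1: "(norm (x + t *\<^sub>R v) / 2)\<^sup>2 \<le> m\<^sup>2 - q / 2" by simp
  have "norm (x - t *\<^sub>R v) \<le> t * e + (1 - t)"
  proof -
    have "x - t *\<^sub>R v = t *\<^sub>R (x - v) + (1 - t) *\<^sub>R x" by (simp add: algebra_simps)
    thus ?thesis
      using norm_triangle_ineq[of "t *\<^sub>R (x - v)" "(1 - t) *\<^sub>R x"] x t by (simp add: e_def)
  qed
  hence "(norm (x - t *\<^sub>R v))\<^sup>2 \<le> (t * e + (1 - t))\<^sup>2" by (intro power_mono) auto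
  also have "\<dots> \<le> 2 * (t * e)\<^sup>2 + 2 * (1 - t)\<^sup>2"
    using zero_le_power2[of "t * e - (1 - t)"] by (simp add: power2_eq_square algebra_simps)
  also have "(t * e)\<^sup>2 \<le> t * e\<^sup>2"
    using t by (auto simp: power_mult_distrib power2_eq_square[of t] intro!: mult_right_mono mult_left_le)
  finally have "\<kappa> * (norm (x - t *\<^sub>R v))\<^sup>2 \<le> \<kappa> * (2 * (t * e\<^sup>2) + 2 * (1 - t)\<^sup>2)"
    using \<kappa> by (intro mult_left_mono) auto
  also have "\<dots> = 2 * (\<kappa> * (t * e\<^sup>2)) + 2 * (\<kappa> * (1 - t)\<^sup>2)" by (simp add: algebra_simps)
  \<comment> \<open>\<open>\<kappa> \<le> k / 4\<close> pays for the angular part out of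
    \<open>q / 2\<close>; \<open>\<kappa> \<le> 1 / 8\<close> leaves
    \<open>(1 - t)\<^sup>2 / 4\<close>, which together with \<open>m\<^sup>2\<close> is exactly the
    right-hand side.\<close>
  also have "\<dots> \<le> 2 * (k / 4 * (t * e\<^sup>2)) + 2 * (1 / 8 * (1 - t)\<^sup>2)"
    using \<kappa> t by (intro add_mono mult_left_mono mult_right_mono) auto
  finally have "\<kappa> * (norm (x - t *\<^sub>R v))\<^sup>2 \<le> q / 2 + (1 - t)\<^sup>2 / 4"
    by (simp add: q_def mult.left_commute)
  with 1 show ?thesis by (simp add: m_def power2_eq_square field_simps)
qed

text \<open>The inequality is symmetric and homogeneous of degree two, so it reduces to a unit
  vector and one that is not longer, as in \<open>midpoint_unit\<close>.\<close>

lemma two_uniformly_convex_midpoint: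
  fixes E :: "'a::real_normed_vector itself"
  assumes "two_uniformly_convex E"
  obtains \<kappa> where "\<kappa> > 0"
    and "\<And>x y :: 'a. (norm ((x + y) /\<^sub>R 2))\<^sup>2 + \<kappa> * (norm (x - y))\<^sup>2 \<le> (norm x)\<^sup>2 / 2 + (norm y)\<^sup>2 / 2"
proof -
  from assms obtain k where k: "k > 0"
    "\<And>\<epsilon>. \<epsilon> \<in> {0<..2} \<Longrightarrow> modulus_of_convexity E \<epsilon> \<ge> ennreal (k * \<epsilon>\<^sup>2)"
    unfolding two_uniformly_convex_def by blast
  have conv: "norm (x + v) / 2 \<le> 1 - k * (norm (x - v))\<^sup>2" if u: "norm x = 1" "norm v = 1" for x v :: 'a
  proof (cases "x = v")
    case True
    thus ?thesis using u norm_scaleR[of 2 v] by (simp flip: scaleR_2)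
  next
    case False
    have "norm (x - v) \<le> 2" "norm (x + v) \<le> 2"
      using norm_triangle_ineq4[of x v] norm_triangle_ineq[of x v] u by simp_all
    hence "ennreal (k * (norm (x - v))\<^sup>2) \<le> modulus_of_convexity E (norm (x - v))"
      using False by (intro k(2)) auto
    also have "\<dots> \<le> ennreal (1 - norm (x + v) / 2)"
      unfolding modulus_of_convexity_def by (rule INF_lower2[of "(x, v)"]) (use u in auto)
    finally show ?thesis using \<open>norm (x + v) \<le> 2\<close> by (subst (asm) ennreal_le_iff) auto
  qed
  define \<kappa> where "\<kappa> = min (1 / 8) (k / 4)"
  have \<kappa>: "\<kappa> > 0" "\<kappa> \<le> 1 / 8" "\<kappa> \<le> k / 4" using k by (auto simp: \<kappa>_def)
  let ?P = "\<lambda>x y :: 'a. (norm ((x + y) /\<^sub>R 2))\<^sup>2 + \<kappa> * (norm (x - y))\<^sup>2 \<le> (norm x)\<^sup>2 / 2 + (norm y)\<^sup>2 / 2"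
  have main: "?P x y" if xy: "norm y \<le> norm x" for x y :: 'a
  proof (cases "x = 0")
    case True
    with xy show ?thesis by simp
  next
    case False
    define s where "s = norm x"
    define t where "t = norm y / s"
    have s: "s > 0" using False by (simp add: s_def)
    define u where "u = x /\<^sub>R s"
    \<comment> \<open>For \<open>y = 0\<close> the direction is arbitrary, since
      \<open>t = 0\<close>; the unit vector \<open>u\<close> is taken.\<close>
    obtain v where v: "norm v = 1" "y = (s * t) *\<^sub>R v"
    proof (cases "y = 0")
      case True
      thus ?thesis using that[of u] s by (simp add: u_def t_def s_def)
    next
      case False
      thus ?thesis using that[of "y /\<^sub>R norm y"] s by (simp add: t_def)
    qed
    have u: "norm u = 1" "x = s *\<^sub>R u" using s by (simp_all add: u_def s_def)
    have t: "0 \<le> t" "t \<le> 1" using xy s by (simp_all add: t_def s_def)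
    have "(norm (u + t *\<^sub>R v) / 2)\<^sup>2 + \<kappa> * (norm (u - t *\<^sub>R v))\<^sup>2 \<le> 1 / 2 + t\<^sup>2 / 2"
      by (rule midpoint_unit[where k = k]) (use conv u v t \<kappa> in auto)
    hence le: "s\<^sup>2 * ((norm (u + t *\<^sub>R v) / 2)\<^sup>2 + \<kappa> * (norm (u - t *\<^sub>R v))\<^sup>2) \<le> s\<^sup>2 * (1 / 2 + t\<^sup>2 / 2)"
      by (intro mult_left_mono) auto
    have xy: "x + y = s *\<^sub>R (u + t *\<^sub>R v)" "x - y = s *\<^sub>R (u - t *\<^sub>R v)"
      using u v by (simp_all add: algebra_simps)
    have n: "norm ((x + y) /\<^sub>R 2) = s * norm (u + t *\<^sub>R v) / 2" "norm (x - y) = s * norm (u - t *\<^sub>R v)"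
      unfolding xy using s by simp_all
    have "norm x = s" "norm y = s * t" using s by (simp_all add: s_def t_def)
    with le show ?thesis unfolding n by (simp add: power_mult_distrib power_divide algebra_simps)
  qed
  have "?P x y" for x y :: 'a
  proof (cases "norm y \<le> norm x")
    case False
    hence "?P y x" by (intro main) simp
    moreover have "y + x = x + y" by (rule add.commute)
    moreover have "norm (y - x) = norm (x - y)" by (rule norm_minus_commute)
    ultimately show ?thesis by (simp only: add.commute[of "(norm x)\<^sup>2 / 2"])
  qed (rule main)
  with \<kappa>(1) show ?thesis using that by blast
qed

locale smooth_convex_space = smooth_space E for E :: "'a::banach itself" +
  assumes convex: "two_uniformly_convex E"
begin

text \<open>The subgradient inequality at \<open>y\<close> is tested at the midpoint, whose norm the
  midpoint inequality bounds; clearing denominators doubles the constant.\<close>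

lemma phi_lower:
  obtains \<kappa> where "\<kappa> > 0" and "\<And>x y :: 'a. \<kappa> * (norm (x - y))\<^sup>2 \<le> \<phi> x y"
proof -
  obtain \<kappa> where \<kappa>: "\<kappa> > 0"
    "\<And>x y :: 'a. (norm ((x + y) /\<^sub>R 2))\<^sup>2 + \<kappa> * (norm (x - y))\<^sup>2 \<le> (norm x)\<^sup>2 / 2 + (norm y)\<^sup>2 / 2"
    using two_uniformly_convex_midpoint[OF convex] by metis
  have "2 * \<kappa> * (norm (x - y))\<^sup>2 \<le> \<phi> x y" for x y :: 'a
  proof -
    have "J y ((x + y) /\<^sub>R 2 - y) \<le> (norm ((x + y) /\<^sub>R 2))\<^sup>2 / 2 - (norm y)\<^sup>2 / 2"
      by (rule J_subgradient)
    with \<kappa>(2)[of x y] show ?thesis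
      by (simp add: lyapunov_def blinfun.diff_right blinfun.add_right blinfun.scaleR_right J_props field_simps)
  qed
  with \<kappa>(1) show ?thesis using that[of "2 * \<kappa>"] by simp
qed

lemma phi_eq_0: "\<phi> x (y :: 'a) \<le> 0 \<Longrightarrow> x = y"
proof (rule phi_lower)
  fix \<kappa> :: real
  assume \<kappa>: "\<kappa> > 0" "\<And>x y :: 'a. \<kappa> * (norm (x - y))\<^sup>2 \<le> \<phi> x y" and "\<phi> x y \<le> 0"
  hence "\<kappa> * (norm (x - y))\<^sup>2 \<le> 0" by (meson order_trans)
  thus "x = y" using \<kappa>(1) by (simp add: mult_le_0_iff)
qed

text \<open>The greatest constant is attained: the admissible ones not below some \<open>c0\<close>
  form a nonempty compact set. Hence \<open>c\<close> satisfies its defining inequality, which makes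
  the inverse of \<open>J\<close> Lipschitz.\<close>

lemma two_uniform_convexity_c:
  defines "c \<equiv> two_uniform_convexity_c TYPE('a)"
  shows "0 < c" "norm (x - y :: 'a) \<le> 2 / c\<^sup>2 * norm (J x - J y)"
proof -
  obtain \<kappa> where \<kappa>: "\<kappa> > 0" "\<And>x y :: 'a. \<kappa> * (norm (x - y))\<^sup>2 \<le> \<phi> x y"
    using phi_lower by metis
  have lip: "\<kappa> * norm (x - y) \<le> norm (J x - J y)" for x y :: 'a
  proof (cases "x = y")
    case False
    have "2 * \<kappa> * (norm (x - y))\<^sup>2 \<le> \<phi> x y + \<phi> y x"
      using \<kappa>(2)[of x y] \<kappa>(2)[of y x] by (simp add: norm_minus_commute)
    also have "\<dots> \<le> 2 * (norm (J x - J y) * norm (x - y))"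
      unfolding phi_add_swap using norm_blinfun[of "J x - J y" "x - y"] by simp
    finally show ?thesis using False by (simp add: power2_eq_square)
  qed simp
  \<comment> \<open>\<open>lip\<close> is the required inequality for
    \<open>c\<^sup>2 = 2 * \<kappa>\<close>; the minimum enforces \<open>c \<le> 1\<close>.\<close>
  define c0 where "c0 = min 1 (sqrt (2 * \<kappa>))"
  have c0: "0 < c0" "c0 \<le> 1" using \<kappa> by (auto simp: c0_def)
  \<comment> \<open>Multiplied by \<open>c\<^sup>2\<close>, the condition has no division and is
    visibly closed in \<open>c\<close>.\<close>
  define Q where "Q = {c :: real. \<forall>x y :: 'a. c\<^sup>2 * norm (x - y) \<le> 2 * norm (J x - J y)}"
  define P where "P c \<longleftrightarrow> 0 < c \<and> c \<le> 1 \<and> (\<forall>x y :: 'a. norm (x - y) \<le> 2 / c\<^sup>2 * norm (J x - J y))" for c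
  have PQ: "P c \<longleftrightarrow> 0 < c \<and> c \<le> 1 \<and> c \<in> Q" for c
    by (cases "c > 0") (simp_all add: field_simps P_def Q_def)
  have "c0 \<in> Q" unfolding Q_def
  proof (intro CollectI allI)
    fix x y :: 'a
    have "c0\<^sup>2 \<le> (sqrt (2 * \<kappa>))\<^sup>2" using c0 by (intro power_mono) (auto simp: c0_def)
    hence "c0\<^sup>2 * norm (x - y) \<le> 2 * \<kappa> * norm (x - y)" using \<kappa> by (intro mult_right_mono) auto
    thus "c0\<^sup>2 * norm (x - y) \<le> 2 * norm (J x - J y)" using lip[of x y] by simp
  qed
  hence ne: "c0 \<in> {c0..1} \<inter> Q" using c0 by auto
  have "closed Q" unfolding Q_def
    by (intro closed_Collect_all closed_Collect_le continuous_intros)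
  hence "compact ({c0..1} \<inter> Q)" by (intro compact_Int_closed compact_Icc)
  from compact_attains_sup[OF this] ne obtain cm where
    cm: "cm \<in> {c0..1} \<inter> Q" "\<And>c. c \<in> {c0..1} \<inter> Q \<Longrightarrow> c \<le> cm" by blast
  have "P cm" unfolding PQ using cm(1) c0 by auto
  moreover have "c \<le> cm" if "P c" for c
    using that cm(2)[of c] cm(1) c0 unfolding PQ by (cases "c0 \<le> c") auto
  ultimately have "Greatest P = cm" by (rule Greatest_equality)
  hence "c = cm" by (simp add: c_def two_uniform_convexity_c_def P_def[abs_def])
  with \<open>P cm\<close> show "0 < c" "norm (x - y :: 'a) \<le> 2 / c\<^sup>2 * norm (J x - J y)"
    unfolding P_def by blast+
qed

lemma J_inverse_tendsto:
  assumes "((\<lambda>n. J (g n)) \<longlongrightarrow> J (l :: 'a)) G"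
  shows "(g \<longlongrightarrow> l) G"
proof -
  let ?c = "two_uniform_convexity_c TYPE('a)"
  have "((\<lambda>n. 2 / ?c\<^sup>2 * norm (J (g n) - J l)) \<longlongrightarrow> 2 / ?c\<^sup>2 * norm (J l - J l)) G"
    by (intro tendsto_intros assms)
  hence "((\<lambda>n. 2 / ?c\<^sup>2 * norm (J (g n) - J l)) \<longlongrightarrow> 0) G" by simp
  hence "((\<lambda>n. g n - l) \<longlongrightarrow> 0) G"
    by (rule Lim_null_comparison[rotated]) (use two_uniform_convexity_c(2) in auto)
  thus ?thesis by (subst Lim_null)
qed

lemma phi_tendsto_0:
  assumes "((\<lambda>n. \<phi> (g n) (h n)) \<longlongrightarrow> 0) G"
  shows "((\<lambda>n. (g n :: 'a) - h n) \<longlongrightarrow> 0) G"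
proof -
  obtain \<kappa> where \<kappa>: "\<kappa> > 0" "\<And>x y :: 'a. \<kappa> * (norm (x - y))\<^sup>2 \<le> \<phi> x y"
    using phi_lower by metis
  have "((\<lambda>n. sqrt (\<phi> (g n) (h n) / \<kappa>)) \<longlongrightarrow> sqrt (0 / \<kappa>)) G"
    by (intro tendsto_intros assms) (use \<kappa> in auto)
  hence lim: "((\<lambda>n. sqrt (\<phi> (g n) (h n) / \<kappa>)) \<longlongrightarrow> 0) G" by simp
  have le: "norm (g n - h n) \<le> sqrt (\<phi> (g n) (h n) / \<kappa>)" for n
    using \<kappa>(2)[of "g n" "h n"] \<kappa>(1) by (intro real_le_rsqrt) (simp add: field_simps)
  show ?thesis
    by (rule Lim_null_comparison[OF _ lim]) (use le in auto)
qed

end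

section \<open>Existence of resolvents\<close>

text \<open>The strategy minimizes the sum of the squared positive parts \<open>w i\<close> of the payoffs: stationarity
  gives \<open>(\<Sum>i\<in>I. (w i)\<^sup>2) \<le> (\<Sum>i\<in>I. w i * a i k)\<close> for each \<open>k\<close>, and the average over \<open>k\<close> with weights
  \<open>w k\<close> is nonpositive on the right.\<close>

lemma nonpositive_payoff_strategy:
  fixes a :: "'i \<Rightarrow> 'i \<Rightarrow> real"
  assumes I: "finite I" "I \<noteq> {}"
    and a: "\<And>i j. i \<in> I \<Longrightarrow> j \<in> I \<Longrightarrow> a i j + a j i \<le> 0"
  obtains \<mu> where "\<And>i. i \<in> I \<Longrightarrow> \<mu> i \<ge> 0" "sum \<mu> I = 1" "\<And>i. i \<in> I \<Longrightarrow> (\<Sum>j\<in>I. \<mu> j * a i j) \<le> 0"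
proof -
  \<comment> \<open>The simplex over \<open>I\<close>, with coordinates outside \<open>I\<close>
    frozen at \<open>0\<close> so that the product is compact in the full function space.\<close>
  define S where "S = (\<Pi>\<^sub>E i\<in>UNIV. if i \<in> I then {0..1::real} else {0}) \<inter> {\<mu>. sum \<mu> I = 1}"
  define s where "s \<mu> i = (\<Sum>j\<in>I. \<mu> j * a i j)" for \<mu> i
  define F where "F \<mu> = (\<Sum>i\<in>I. (max 0 (s \<mu> i))\<^sup>2)" for \<mu>
  have coord: "continuous_on A (\<lambda>\<mu>::'i \<Rightarrow> real. \<mu> i)" for A i
    by (rule continuous_on_subset[OF continuous_on_product_coordinates]) simp
  have "compactin (product_topology (\<lambda>i::'i. euclideanreal) UNIV) (\<Pi>\<^sub>E i\<in>UNIV. if i \<in> I then {0..1} else {0})"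
    unfolding compactin_PiE by auto
  moreover have "closed {\<mu>::'i \<Rightarrow> real. sum \<mu> I = 1}"
    by (intro closed_Collect_eq continuous_intros coord)
  ultimately have "compact S"
    unfolding S_def by (intro compact_Int_closed) (simp_all add: euclidean_product_topology)
  moreover obtain i0 where i0: "i0 \<in> I" using I by blast
  hence "(\<lambda>i. if i = i0 then 1 else 0) \<in> S"
    using I by (auto simp: S_def PiE_def Pi_def)
  moreover have "continuous_on S F"
    unfolding F_def s_def by (intro continuous_intros coord)
  ultimately obtain \<mu> where \<mu>: "\<mu> \<in> S" "\<And>\<nu>. \<nu> \<in> S \<Longrightarrow> F \<mu> \<le> F \<nu>"
    using continuous_attains_inf[of S F] by blast
  have \<mu>1: "sum \<mu> I = 1" and \<mu>0: "\<mu> i \<ge> 0" if "i \<in> I" for i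
    using \<mu>(1) i0 that by (auto simp: S_def PiE_def Pi_def split: if_splits)
  define w where "w i = max 0 (s \<mu> i)" for i
  have w: "w i \<ge> 0" for i by (simp add: w_def)
  have variation: "(\<Sum>i\<in>I. w i * a i k) \<ge> (\<Sum>i\<in>I. (w i)\<^sup>2)" if k: "k \<in> I" for k
  proof -
    define D where "D = (\<Sum>i\<in>I. w i * (a i k - s \<mu> i))"
    define B where "B = (\<Sum>i\<in>I. (a i k - s \<mu> i)\<^sup>2)"
    \<comment> \<open>Minimality of \<open>\<mu>\<close> against the mixture \<open>\<nu>\<close>, a
      step \<open>t\<close> towards the vertex \<open>k\<close>, divided by
      \<open>t\<close>.\<close>
    have quad: "0 \<le> 2 * D + t * B" if t: "0 < t" "t \<le> 1" for t
    proof -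
      define \<nu> where "\<nu> i = (1 - t) * \<mu> i + t * (if i = k then 1 else 0)" for i
      have "sum \<nu> I = 1"
        using I k \<mu>1[OF k] by (simp add: \<nu>_def sum.distrib flip: sum_distrib_left)
      moreover have "\<nu> i \<in> (if i \<in> I then {0..1} else {0})" for i
      proof (cases "i \<in> I")
        case True
        hence "0 \<le> \<mu> i" "\<mu> i \<le> 1" using \<mu>(1) by (auto simp: S_def PiE_def Pi_def split: if_splits)
        hence "0 \<le> \<nu> i"
          unfolding \<nu>_def using t by (auto intro!: add_nonneg_nonneg mult_nonneg_nonneg)
        moreover have "\<nu> i \<le> (1 - t) * 1 + t * 1"
          unfolding \<nu>_def using t \<open>\<mu> i \<le> 1\<close> by (intro add_mono mult_left_mono) auto
        ultimately show ?thesis using True by simp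
      next
        case False
        thus ?thesis using k \<mu>(1) by (auto simp: \<nu>_def S_def PiE_def Pi_def split: if_splits)
      qed
      ultimately have "\<nu> \<in> S" by (auto simp: S_def)
      hence "F \<mu> \<le> F \<nu>" by (rule \<mu>(2))
      also have "F \<nu> \<le> (\<Sum>i\<in>I. (w i)\<^sup>2 + 2 * w i * (t * (a i k - s \<mu> i)) + (t * (a i k - s \<mu> i))\<^sup>2)"
        unfolding F_def
      proof (rule sum_mono)
        fix i
        have "\<nu> j * a i j = \<mu> j * a i j + t * ((if j = k then a i j else 0) - \<mu> j * a i j)" for j
          by (simp add: \<nu>_def algebra_simps)
        hence eq: "s \<nu> i = s \<mu> i + t * (a i k - s \<mu> i)"
          using I k by (simp add: s_def sum.distrib sum_subtractf flip: sum_distrib_left)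
        \<comment> \<open>A quadratic upper bound for the squared positive part; it replaces
          differentiation.\<close>
        have "(max 0 (p + v))\<^sup>2 \<le> (max 0 p)\<^sup>2 + 2 * max 0 p * v + v\<^sup>2" for p v :: real
        proof (cases "p \<ge> 0")
          case True
          have "(max 0 (p + v))\<^sup>2 \<le> (p + v)\<^sup>2" by (auto simp: max_def)
          thus ?thesis using True by (simp add: power2_eq_square algebra_simps)
        next
          case False
          hence "max 0 (p + v) \<le> \<bar>v\<bar>" by auto
          hence "(max 0 (p + v))\<^sup>2 \<le> \<bar>v\<bar>\<^sup>2" by (intro power_mono) auto
          thus ?thesis using False by simp
        qed
        thus "(max 0 (s \<nu> i))\<^sup>2 \<le> (w i)\<^sup>2 + 2 * w i * (t * (a i k - s \<mu> i)) + (t * (a i k - s \<mu> i))\<^sup>2"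
          unfolding eq w_def .
      qed
      also have "\<dots> = F \<mu> + t * (2 * D + t * B)"
        by (simp add: F_def w_def D_def B_def sum.distrib sum_distrib_left distrib_left power_mult_distrib
            power2_eq_square mult_ac)
      finally show ?thesis using t by (simp add: zero_le_mult_iff)
    qed
    have "((\<lambda>t. 2 * D + t * B) \<longlongrightarrow> 2 * D + 0 * B) (at_right 0)"
      by (intro tendsto_intros)
    moreover have "\<forall>\<^sub>F t in at_right 0. 0 \<le> 2 * D + t * B"
      unfolding eventually_at_right_field using quad by (intro exI[of _ 1]) auto
    ultimately have "0 \<le> 2 * D + 0 * B" by (intro tendsto_lowerbound) auto
    moreover have "w i * s \<mu> i = (w i)\<^sup>2" for i
      by (simp add: w_def max_def power2_eq_square)
    hence "D = (\<Sum>i\<in>I. w i * a i k) - (\<Sum>i\<in>I. (w i)\<^sup>2)"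
      by (simp add: D_def right_diff_distrib sum_subtractf)
    ultimately show ?thesis by simp
  qed
  have "(\<Sum>i\<in>I. (w i)\<^sup>2) * sum w I \<le> (\<Sum>k\<in>I. w k * (\<Sum>i\<in>I. w i * a i k))"
    unfolding sum_distrib_left
    by (rule sum_mono) (use variation w in \<open>auto simp: mult.commute sum_distrib_left[symmetric] intro!: mult_left_mono\<close>)
  also have "\<dots> = (\<Sum>k\<in>I. \<Sum>i\<in>I. w k * w i * a i k)"
    by (simp add: sum_distrib_left mult.assoc)
  also have "\<dots> \<le> 0"
  proof -
    let ?T = "\<Sum>k\<in>I. \<Sum>i\<in>I. w k * w i * a i k"
    \<comment> \<open>Exchanging the two summation indices symmetrizes the sum, so that the
      hypothesis on \<open>a i k + a k i\<close> applies.\<close>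
    have "?T = (\<Sum>k\<in>I. \<Sum>i\<in>I. w k * w i * a k i)"
      by (subst sum.swap) (simp add: mult.commute)
    hence "?T + ?T = (\<Sum>k\<in>I. \<Sum>i\<in>I. w k * w i * (a i k + a k i))"
      by (simp add: distrib_left sum.distrib)
    also have "\<dots> \<le> 0"
      using a w by (intro sum_nonpos) (simp add: mult_nonneg_nonpos)
    finally show ?thesis by simp
  qed
  finally have "(\<Sum>i\<in>I. (w i)\<^sup>2) * sum w I \<le> 0" .
  \<comment> \<open>One nonzero weight would make the product positive, against the bound just
    shown.\<close>
  moreover have "(\<Sum>i\<in>I. (w i)\<^sup>2) * sum w I > 0" if i: "i \<in> I" "w i \<noteq> 0" for i
  proof -
    have "w i > 0" using i(2) w[of i] by linarith
    thus ?thesis using i(1) I w by (intro mult_pos_pos sum_pos2[of I i]) auto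
  qed
  ultimately have "w i = 0" if "i \<in> I" for i using that by (meson linorder_not_le)
  hence "s \<mu> i \<le> 0" if "i \<in> I" for i using that by (force simp: w_def)
  thus ?thesis using that[of \<mu>] \<mu>0 \<mu>1 i0 unfolding s_def by blast
qed

text \<open>Almost minimal points of the finite intersections form a Cauchy sequence by the midpoint
  inequality, as in the proof that uniformly convex spaces are reflexive.\<close>

lemma closed_convex_fip:
  fixes \<F> :: "'a::banach set set"
  assumes \<kappa>: "\<kappa> > 0" "\<And>x y :: 'a. (norm ((x + y) /\<^sub>R 2))\<^sup>2 + \<kappa> * (norm (x - y))\<^sup>2 \<le> (norm x)\<^sup>2 / 2 + (norm y)\<^sup>2 / 2"
    and \<F>: "\<And>G. G \<in> \<F> \<Longrightarrow> closed G" "\<And>G. G \<in> \<F> \<Longrightarrow> convex G"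
    and B: "B \<in> \<F>" "bounded B"
    and fip: "\<And>X. finite X \<Longrightarrow> X \<noteq> {} \<Longrightarrow> X \<subseteq> \<F> \<Longrightarrow> \<Inter>X \<noteq> {}"
  shows "\<Inter>\<F> \<noteq> {}"
proof -
  \<comment> \<open>Including \<open>B\<close> in every subfamily bounds the infima
    \<open>m X\<close> by \<open>R\<^sup>2\<close>, so their supremum \<open>D\<close> is
    finite.\<close>
  define \<X> where "\<X> = {X. finite X \<and> B \<in> X \<and> X \<subseteq> \<F>}"
  have ne: "\<Inter>X \<noteq> {}" if "X \<in> \<X>" for X using that fip unfolding \<X>_def by blast
  define m where "m X = (INF z\<in>\<Inter>X. (norm z)\<^sup>2)" for X :: "'a set set"
  have m_le: "m X \<le> (norm z)\<^sup>2" if "z \<in> \<Inter>X" for X z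
    unfolding m_def using that by (intro cINF_lower bdd_belowI2[of _ 0]) auto
  obtain R where R: "\<And>z. z \<in> B \<Longrightarrow> norm z \<le> R" using B(2) by (auto simp: bounded_iff)
  have m_R: "m X \<le> R\<^sup>2" if X: "X \<in> \<X>" for X
  proof -
    obtain z where z: "z \<in> \<Inter>X" using ne[OF X] by blast
    hence "(norm z)\<^sup>2 \<le> R\<^sup>2" using R X by (intro power_mono) (auto simp: \<X>_def)
    with m_le[OF z] show ?thesis by simp
  qed
  define D where "D = (SUP X\<in>\<X>. m X)"
  have X0: "{B} \<in> \<X>" using B by (simp add: \<X>_def)
  have m_D: "m X \<le> D" if "X \<in> \<X>" for X
    unfolding D_def using that m_R by (intro cSUP_upper bdd_aboveI2[of _ _ "R\<^sup>2"]) auto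
  define W where "W X \<epsilon> = {z \<in> \<Inter>X. (norm z)\<^sup>2 < D + \<epsilon>}" for X :: "'a set set" and \<epsilon>
  have W_ne: "\<exists>z. z \<in> W X \<epsilon>" if X: "X \<in> \<X>" and \<epsilon>: "\<epsilon> > 0" for X \<epsilon>
  proof -
    have "m X < D + \<epsilon>" using m_D[OF X] \<epsilon> by simp
    hence "\<exists>z\<in>\<Inter>X. (norm z)\<^sup>2 < D + \<epsilon>"
      unfolding m_def using ne[OF X] by (subst (asm) cINF_less_iff) (auto intro: bdd_belowI2[of _ 0])
    thus ?thesis by (auto simp: W_def)
  qed
  \<comment> \<open>The midpoint lies in the same convex intersection, so its squared norm is at
    least \<open>m X > D - \<epsilon>\<close>; the midpoint inequality then forces the two points
    together.\<close>
  have W_small: "(norm (z - z'))\<^sup>2 \<le> 2 * \<epsilon> / \<kappa>"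
    if X: "X \<in> \<X>" "D - \<epsilon> < m X" and z: "z \<in> W X \<epsilon>" "z' \<in> W X \<epsilon>" for X \<epsilon> z z'
  proof -
    have "(z + z') /\<^sub>R 2 \<in> \<Inter>X"
    proof
      fix G assume G: "G \<in> X"
      hence "convex G" "z \<in> G" "z' \<in> G" using X z \<F>(2) by (auto simp: \<X>_def W_def)
      hence "(1 / 2) *\<^sub>R z + (1 / 2) *\<^sub>R z' \<in> G" by (intro convexD) auto
      thus "(z + z') /\<^sub>R 2 \<in> G" by (simp add: scaleR_add_right)
    qed
    from m_le[OF this] \<kappa>(2)[of z z'] X(2) z
    have "\<kappa> * (norm (z - z'))\<^sup>2 \<le> 2 * \<epsilon>" by (simp add: W_def)
    thus ?thesis using \<kappa>(1) by (simp add: field_simps)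
  qed
  define \<epsilon> where "\<epsilon> n = 1 / real (Suc n)" for n
  have \<epsilon>: "\<epsilon> n > 0" for n by (simp add: \<epsilon>_def)
  have \<epsilon>_mono: "\<epsilon> n \<le> \<epsilon> k" if "k \<le> n" for n k using that by (simp add: \<epsilon>_def field_simps)
  have \<epsilon>_lim: "(\<lambda>n. sqrt (2 * \<epsilon> n / \<kappa>)) \<longlonglongrightarrow> 0"
  proof -
    have "(\<lambda>n. sqrt (2 * \<epsilon> n / \<kappa>)) \<longlonglongrightarrow> sqrt (2 * 0 / \<kappa>)"
      unfolding \<epsilon>_def using \<kappa>(1)
      by (intro tendsto_intros LIMSEQ_Suc[OF lim_1_over_n]) auto
    thus ?thesis by simp
  qed
  have "\<exists>X\<in>\<X>. D - \<epsilon> n < m X" for n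
  proof -
    have "D - \<epsilon> n < D" using \<epsilon> by simp
    thus ?thesis unfolding D_def using X0 m_R
      by (subst (asm) less_cSUP_iff) (auto intro: bdd_aboveI2[of _ _ "R\<^sup>2"])
  qed
  then obtain X where X: "\<And>n. X n \<in> \<X>" "\<And>n. D - \<epsilon> n < m (X n)" by metis
  \<comment> \<open>The unions make the subfamilies increase with \<open>n\<close>, while points of
    their intersections stay in that of \<open>X n\<close>, where \<open>W_small\<close>
    applies.\<close>
  define Z where "Z n = (\<Union>k\<le>n. X k)" for n
  have Z: "Z n \<in> \<X>" for n using X(1) by (fastforce simp: Z_def \<X>_def)
  have "\<forall>n. \<exists>z. z \<in> W (Z n) (\<epsilon> n)" using W_ne[OF Z \<epsilon>] by blast
  then obtain v where v: "\<And>n. v n \<in> W (Z n) (\<epsilon> n)" by metis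
  have close: "norm (v n - z) \<le> sqrt (2 * \<epsilon> n / \<kappa>)" if "z \<in> W Y (\<epsilon> k)" "Z n \<subseteq> Y" "n \<le> k" for n k Y z
  proof -
    have "z \<in> W (X n) (\<epsilon> n)"
      using that \<epsilon>_mono[OF that(3)] by (fastforce simp: W_def Z_def)
    moreover have "v n \<in> W (X n) (\<epsilon> n)" using v[of n] by (fastforce simp: W_def Z_def)
    ultimately have "(norm (v n - z))\<^sup>2 \<le> 2 * \<epsilon> n / \<kappa>" using W_small X by blast
    thus ?thesis by (rule real_le_rsqrt)
  qed
  have Z_mono: "Z k \<subseteq> Z n" if "k \<le> n" for k n using that by (force simp: Z_def)
  have "Cauchy v"
  proof (rule metric_CauchyI)
    fix e :: real assume "e > 0"
    with \<epsilon>_lim have "\<forall>\<^sub>F n in sequentially. sqrt (2 * \<epsilon> n / \<kappa>) < e / 2"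
      by (intro order_tendstoD(2)) auto
    then obtain n where n: "sqrt (2 * \<epsilon> n / \<kappa>) < e / 2" by (auto simp: eventually_sequentially)
    show "\<exists>M. \<forall>p\<ge>M. \<forall>q\<ge>M. dist (v p) (v q) < e"
    proof (intro exI allI impI)
      fix p q assume "p \<ge> n" "q \<ge> n"
      hence "dist (v n) (v p) < e / 2" "dist (v n) (v q) < e / 2"
        using close[OF v Z_mono] n unfolding dist_norm by (meson le_less_trans)+
      thus "dist (v p) (v q) < e" by (rule dist_triangle_half_r)
    qed
  qed
  then obtain l where l: "v \<longlonglongrightarrow> l" by (meson convergentD Cauchy_convergent_iff)
  have "l \<in> G" if G: "G \<in> \<F>" for G
  proof -
    \<comment> \<open>Adjoining \<open>G\<close> yields almost minimal points \<open>g n\<close> in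
      \<open>G\<close> that are as close to \<open>v n\<close> as before, hence have the same
      limit.\<close>
    have "insert G (Z n) \<in> \<X>" for n using Z[of n] G by (auto simp: \<X>_def)
    hence "\<forall>n. \<exists>z. z \<in> W (insert G (Z n)) (\<epsilon> n)" using W_ne[OF _ \<epsilon>] by blast
    then obtain g where g: "\<And>n. g n \<in> W (insert G (Z n)) (\<epsilon> n)" by metis
    have "(\<lambda>n. v n - g n) \<longlonglongrightarrow> 0"
      by (intro Lim_null_comparison[OF _ \<epsilon>_lim] always_eventually allI close[OF g]) auto
    from tendsto_diff[OF l this] have "g \<longlonglongrightarrow> l" by simp
    moreover have "g n \<in> G" for n using g[of n] by (simp add: W_def)
    ultimately show ?thesis using \<F>(1)[OF G] by (meson closed_sequentially)
  qed
  thus ?thesis by blast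
qed

lemma lsc_onD:
  assumes "lsc_on C g" "x \<in> C" "\<epsilon> > 0"
  shows "\<forall>\<^sub>F y in at x within C. g x - \<epsilon> < g y"
proof -
  have "ereal (g x - \<epsilon>) < Liminf (at x within C) (\<lambda>y. ereal (g y))"
    using assms by (force simp: lsc_on_def intro: less_le_trans[of _ "ereal (g x)"])
  from less_LiminfD[OF this] show ?thesis by simp
qed

text \<open>The limit inferior ignores the point \<open>x\<close> itself; since
  \<open>\<epsilon> > 0\<close>, the bound also holds there.\<close>

lemma lsc_on_ball:
  fixes C :: "'a::metric_space set"
  assumes "lsc_on C g" "x \<in> C" "\<epsilon> > 0"
  obtains \<delta> where "\<delta> > 0" "\<And>y. y \<in> C \<Longrightarrow> dist y x < \<delta> \<Longrightarrow> g x - \<epsilon> < g y"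
proof -
  from lsc_onD[OF assms] obtain \<delta> where \<delta>: "\<delta> > 0"
    "\<And>y. y \<in> C \<Longrightarrow> y \<noteq> x \<Longrightarrow> dist y x < \<delta> \<Longrightarrow> g x - \<epsilon> < g y"
    unfolding eventually_at by blast
  have "g x - \<epsilon> < g y" if "y \<in> C" "dist y x < \<delta>" for y
    using \<delta>(2)[OF that(1) _ that(2)] assms(3) by (cases "y = x") auto
  with \<delta>(1) show ?thesis using that by blast
qed

lemma lsc_on_lim_le:
  fixes C :: "'a::metric_space set"
  assumes g: "lsc_on C g" "x \<in> C" and u: "u \<longlonglongrightarrow> x" "\<And>n. u n \<in> C"
    and h: "h \<longlonglongrightarrow> (l::real)" "\<And>n. g (u n) \<le> h n"
  shows "g x \<le> l"
proof (rule field_le_epsilon)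
  fix \<epsilon> :: real assume "\<epsilon> > 0"
  then obtain \<delta> where \<delta>: "\<delta> > 0" "\<And>y. y \<in> C \<Longrightarrow> dist y x < \<delta> \<Longrightarrow> g x - \<epsilon> < g y"
    using lsc_on_ball[OF g] by metis
  have "\<forall>\<^sub>F n in sequentially. g x - \<epsilon> \<le> h n"
    using tendstoD[OF u(1) \<delta>(1)]
  proof eventually_elim
    case (elim n)
    thus ?case using \<delta>(2)[OF u(2)] h(2)[of n] by (meson less_imp_le less_le_trans)
  qed
  from tendsto_lowerbound[OF h(1) this] show "g x \<le> l + \<epsilon>" by simp
qed

text \<open>Semicontinuity bounds \<open>g\<close> from below near \<open>x\<close>. For distant
  \<open>z\<close>, convexity along the segment carries the bound at a nearby point \<open>w\<close>
  out to \<open>z\<close>, with a loss linear in the distance.\<close>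

lemma convex_on_lsc_linear_lower_bound:
  fixes C :: "'a::real_normed_vector set"
  assumes g: "convex_on C g" "lsc_on C g" and x: "x \<in> C"
  obtains L where "L \<ge> 0" "\<And>z. z \<in> C \<Longrightarrow> g x - 1 - L * norm (z - x) \<le> g z"
proof -
  obtain \<delta> where \<delta>: "\<delta> > 0" "\<And>y. y \<in> C \<Longrightarrow> dist y x < \<delta> \<Longrightarrow> g x - 1 < g y"
    using lsc_on_ball[OF g(2) x, of 1] by auto
  have "g x - 1 - 2 / \<delta> * norm (z - x) \<le> g z" if z: "z \<in> C" for z
  proof (cases "dist z x < \<delta>")
    case True
    have "0 \<le> 2 / \<delta> * norm (z - x)" using \<delta>(1) by simp
    with \<delta>(2)[OF z True] show ?thesis by linarith
  next
    case False
    \<comment> \<open>Places \<open>w\<close> at distance \<open>\<delta> / 2\<close> from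
      \<open>x\<close>.\<close>
    define s where "s = \<delta> / (2 * norm (z - x))"
    have n: "norm (z - x) \<ge> \<delta>" using False by (simp add: dist_norm)
    have "norm (z - x) > 0" using n \<delta>(1) by linarith
    hence s: "0 < s" "s \<le> 1" using n \<delta>(1) by (simp_all add: s_def field_simps)
    define w where "w = (1 - s) *\<^sub>R x + s *\<^sub>R z"
    have "w \<in> C" using convex_on_imp_convex[OF g(1)] x z s unfolding w_def by (intro convexD) auto
    moreover have "w - x = s *\<^sub>R (z - x)" by (simp add: w_def algebra_simps)
    hence "dist w x < \<delta>" using s n \<delta>(1) by (simp add: dist_norm s_def)
    ultimately have "g x - 1 < g w" by (rule \<delta>(2))
    also have "g w \<le> (1 - s) * g x + s * g z"
      using convex_onD[OF g(1), of s x z] s x z unfolding w_def by simp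
    finally have "s * g x - 1 < s * g z" by (simp add: algebra_simps)
    hence "g x - 1 / s < g z" using s by (simp add: field_simps)
    moreover have "1 / s = 2 / \<delta> * norm (z - x)" using \<delta>(1) by (simp add: s_def)
    ultimately show ?thesis by simp
  qed
  thus ?thesis using that[of "2 / \<delta>"] \<delta>(1) by simp
qed

lemma convex_on_J_potential:
  fixes C :: "'a::real_normed_vector set" and \<xi> :: "'a \<Rightarrow>\<^sub>L real"
  assumes "convex C"
  shows "convex_on C (\<lambda>z. (norm z)\<^sup>2 / 2 - \<xi> z)"
proof (rule convex_onI)
  fix t :: real and x y :: 'a
  assume t: "0 < t" "t < 1"
  define w where "w = (1 - t) *\<^sub>R x + t *\<^sub>R y"
  have "norm w \<le> (1 - t) * norm x + t * norm y"
    using norm_triangle_ineq[of "(1 - t) *\<^sub>R x" "t *\<^sub>R y"] t by (simp add: w_def)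
  hence "(norm w)\<^sup>2 \<le> ((1 - t) * norm x + t * norm y)\<^sup>2"
    by (intro power_mono) auto
  also have "\<dots> = (1 - t) * (norm x)\<^sup>2 + t * (norm y)\<^sup>2 - t * (1 - t) * (norm x - norm y)\<^sup>2"
    by (simp add: power2_eq_square algebra_simps)
  also have "\<dots> \<le> (1 - t) * (norm x)\<^sup>2 + t * (norm y)\<^sup>2"
    using t by simp
  finally have "(norm w)\<^sup>2 \<le> (1 - t) * (norm x)\<^sup>2 + t * (norm y)\<^sup>2" .
  moreover have "\<xi> w = (1 - t) * \<xi> x + t * \<xi> y"
    by (simp add: w_def blinfun.add_right blinfun.scaleR_right)
  ultimately have "(norm w)\<^sup>2 / 2 - \<xi> w \<le> (1 - t) * ((norm x)\<^sup>2 / 2 - \<xi> x) + t * ((norm y)\<^sup>2 / 2 - \<xi> y)"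
    by (simp add: field_simps)
  thus "(norm ((1 - t) *\<^sub>R x + t *\<^sub>R y))\<^sup>2 / 2 - \<xi> ((1 - t) *\<^sub>R x + t *\<^sub>R y)
      \<le> (1 - t) * ((norm x)\<^sup>2 / 2 - \<xi> x) + t * ((norm y)\<^sup>2 / 2 - \<xi> y)"
    by (simp only: w_def)
qed fact

text \<open>Conditions (A1) to (A4) for a single bifunction, to be instantiated with each
  \<open>f k\<close> and with the zero bifunction.\<close>

locale equilibrium =
  fixes C :: "'a::real_normed_vector set" and f :: "'a \<Rightarrow> 'a \<Rightarrow> real"
  assumes C: "C \<noteq> {}" "closed C" "convex C"
    and refl: "x \<in> C \<Longrightarrow> f x x = 0"
    and mono: "x \<in> C \<Longrightarrow> y \<in> C \<Longrightarrow> f x y + f y x \<le> 0"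
    and hemi: "x \<in> C \<Longrightarrow> y \<in> C \<Longrightarrow> z \<in> C \<Longrightarrow>
      Limsup (at_right 0) (\<lambda>t::real. ereal (f (t *\<^sub>R z + (1 - t) *\<^sub>R x) y)) \<le> ereal (f x y)"
    and convex_lsc: "x \<in> C \<Longrightarrow> convex_on C (f x) \<and> lsc_on C (f x)"
begin

lemma segment:
  assumes "x \<in> C" "y \<in> C" "0 \<le> t" "t \<le> 1"
  shows "t *\<^sub>R y + (1 - t) *\<^sub>R x \<in> C"
  using assms C by (intro convexD) auto

lemma f_segment_le:
  assumes "v \<in> C" "x \<in> C" "y \<in> C" "0 \<le> t" "t \<le> 1"
  shows "f v (t *\<^sub>R y + (1 - t) *\<^sub>R x) \<le> t * f v y + (1 - t) * f v x"
proof -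
  have "convex_on C (f v)" using convex_lsc assms by blast
  from convex_onD[OF this assms(4,5,2,3)] show ?thesis by (simp add: add.commute)
qed

text \<open>The form in which (A3) is applied: near \<open>0\<close> the values on the segment stay
  below \<open>f x y + \<epsilon>\<close>, so the inequality survives the passage to
  \<open>x\<close>.\<close>

lemma hemi_limit:
  assumes xyz: "x \<in> C" "y \<in> C" "z \<in> C"
    and g: "(g \<longlongrightarrow> l) (at_right 0)"
    and ge: "\<And>t. 0 < t \<Longrightarrow> t < 1 \<Longrightarrow> 0 \<le> f (t *\<^sub>R z + (1 - t) *\<^sub>R x) y + g t"
  shows "0 \<le> f x y + l"
proof (rule field_le_epsilon)
  fix \<epsilon> :: real assume \<epsilon>: "\<epsilon> > 0"
  have "Limsup (at_right 0) (\<lambda>t::real. ereal (f (t *\<^sub>R z + (1 - t) *\<^sub>R x) y)) < ereal (f x y + \<epsilon>)"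
    using hemi[OF xyz] \<epsilon> by (simp add: le_less_trans)
  from Limsup_lessD[OF this]
  have "\<forall>\<^sub>F t in at_right 0. f (t *\<^sub>R z + (1 - t) *\<^sub>R x) y < f x y + \<epsilon>" by simp
  moreover have "\<forall>\<^sub>F t in at_right 0. 0 < t \<and> t < (1 :: real)"
    by (auto simp: eventually_at_right_field intro: exI[of _ 1])
  ultimately have "\<forall>\<^sub>F t in at_right 0. 0 \<le> f x y + \<epsilon> + g t"
  proof eventually_elim
    case (elim t)
    with ge[of t] show ?case by simp
  qed
  moreover have "((\<lambda>t. f x y + \<epsilon> + g t) \<longlongrightarrow> f x y + \<epsilon> + l) (at_right 0)"
    by (intro tendsto_intros g)
  ultimately show "0 \<le> f x y + l + \<epsilon>"
    using tendsto_lowerbound[of "\<lambda>t. f x y + \<epsilon> + g t"] by (force simp: algebra_simps)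
qed

lemma closed_sublevel:
  assumes y: "y \<in> C" and g: "continuous_on UNIV g"
  shows "closed {z \<in> C. f y z + g z \<le> 0}"
  unfolding closed_sequential_limits
proof (intro allI impI, elim conjE)
  fix u l assume u: "\<forall>n. u n \<in> {z \<in> C. f y z + g z \<le> 0}" and lim: "u \<longlonglongrightarrow> l"
  have l: "l \<in> C" using closed_sequentially[OF C(2) _ lim] u by blast
  have "f y l \<le> - g l"
  proof (rule lsc_on_lim_le[where C = C and u = u])
    show "(\<lambda>n. - g (u n)) \<longlonglongrightarrow> - g l"
      using g lim by (intro tendsto_minus) (simp add: continuous_on_eq_continuous_at isCont_tendsto_compose)
    show "f y (u n) \<le> - g (u n)" for n using u[rule_format, of n] by simp
  qed (use l lim u y convex_lsc in auto)
  with l show "l \<in> {z \<in> C. f y z + g z \<le> 0}" by simp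
qed

text \<open>Minty's argument: at a point \<open>w\<close> between \<open>p\<close> and
  \<open>y\<close>, convexity and \<open>f w w = 0\<close> turn \<open>f w p \<le> 0\<close> into
  \<open>f w y \<ge> 0\<close>; then \<open>w\<close> tends to \<open>p\<close>.\<close>

lemma EP_limit:
  assumes p: "p \<in> C" and le: "\<And>y. y \<in> C \<Longrightarrow> f y p \<le> 0"
  shows "p \<in> EP C f"
proof -
  have "0 \<le> f p y + 0" if y: "y \<in> C" for y
  proof (rule hemi_limit[OF p y y tendsto_const])
    fix t :: real assume t: "0 < t" "t < 1"
    let ?w = "t *\<^sub>R y + (1 - t) *\<^sub>R p"
    have w: "?w \<in> C" using p y t by (intro segment) auto
    have "0 \<le> t * f ?w y + (1 - t) * f ?w p"
      using f_segment_le[OF w p y, of t] refl[OF w] t by simp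
    moreover have "(1 - t) * f ?w p \<le> 0" using le[OF w] t by (simp add: mult_nonneg_nonpos)
    ultimately have "0 \<le> t * f ?w y" by linarith
    thus "0 \<le> f ?w y + 0" using t by (simp add: zero_le_mult_iff)
  qed
  with p show ?thesis by (simp add: EP_def)
qed

end

context smooth_convex_space
begin

text \<open>With \<open>g z = (norm z)\<^sup>2 / 2 - \<xi> z\<close>, whose derivative is \<open>J z - \<xi>\<close>, the bifunction
  \<open>h y z = f y z + (g z - g y) / r\<close> is monotone and convex in \<open>z\<close>. The payoff matrix \<open>h (y i) (y j)\<close>
  of finitely many points then has a strategy giving a common point of the sublevel sets of
  the \<open>h (y i)\<close>; convexity of the norm extends this to all \<open>y\<close>. Using the potential \<open>g\<close> instead of
  its derivative makes these sets bounded.\<close>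

lemma minty_resolvent_exists:
  fixes C :: "'a set" and \<xi> :: "'a \<Rightarrow>\<^sub>L real"
  assumes "equilibrium C f" and r: "r > 0"
  defines "g \<equiv> \<lambda>z. (norm z)\<^sup>2 / 2 - \<xi> z"
  obtains z where "z \<in> C" "\<And>y. y \<in> C \<Longrightarrow> f y z + (g z - g y) / r \<le> 0"
proof -
  interpret equilibrium C f by fact
  obtain \<kappa> where \<kappa>: "\<kappa> > 0"
    "\<And>x y :: 'a. (norm ((x + y) /\<^sub>R 2))\<^sup>2 + \<kappa> * (norm (x - y))\<^sup>2 \<le> (norm x)\<^sup>2 / 2 + (norm y)\<^sup>2 / 2"
    using two_uniformly_convex_midpoint[OF convex] by metis
  define h where "h y z = f y z + (g z - g y) / r" for y z
  define G where "G y = {z \<in> C. h y z \<le> 0}" for y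
  have cont: "continuous_on UNIV (\<lambda>z. (g z - g y) / r)" for y
    unfolding g_def by (intro continuous_intros) (use r in auto)
  have closed: "closed (G y)" if "y \<in> C" for y
    using closed_sublevel[OF that cont] by (simp add: G_def h_def)
  have g_convex: "convex_on C g" unfolding g_def by (rule convex_on_J_potential[OF C(3)])
  have h_convex: "convex_on C (h y)" if "y \<in> C" for y
  proof -
    have "convex_on C (\<lambda>z. f y z + (1 / r) * (g z + (- g y)))"
      using convex_lsc[OF that] g_convex C r
      by (intro convex_on_add convex_on_cmul convex_on_const[THEN iffD2]) auto
    thus ?thesis by (simp add: h_def[abs_def])
  qed
  have convex_G: "convex (G y)" if "y \<in> C" for y
  proof (rule convexI)
    fix u v and s t :: real
    assume uv: "u \<in> G y" "v \<in> G y" and st: "0 \<le> s" "0 \<le> t" "s + t = 1"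
    hence s: "s = 1 - t" and uv': "u \<in> C" "v \<in> C" by (auto simp: G_def)
    have "h y (s *\<^sub>R u + t *\<^sub>R v) \<le> s * h y u + t * h y v"
      unfolding s by (rule convex_onD[OF h_convex[OF that]]) (use st uv' in simp_all)
    also have "\<dots> \<le> 0"
      by (intro add_nonpos_nonpos mult_nonneg_nonpos) (use uv st in \<open>simp_all add: G_def\<close>)
    finally show "s *\<^sub>R u + t *\<^sub>R v \<in> G y"
      unfolding G_def using convexD[OF C(3) uv' st] by blast
  qed
  obtain y0 where y0: "y0 \<in> C" using C by blast
  \<comment> \<open>The loss in the linear lower bound for \<open>f y0\<close> cannot outweigh the
    quadratic growth of \<open>g\<close>.\<close>
  have bounded: "bounded (G y0)"
  proof -
    have "convex_on C (f y0)" "lsc_on C (f y0)" using convex_lsc y0 by auto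
    then obtain L where L: "L \<ge> 0" "\<And>z. z \<in> C \<Longrightarrow> f y0 y0 - 1 - L * norm (z - y0) \<le> f y0 z"
      using convex_on_lsc_linear_lower_bound[of C "f y0" y0] y0 by metis
    \<comment> \<open>\<open>K\<close> and \<open>c\<close> collect the constants of the inequality
      \<open>quad\<close>, which fails beyond \<open>2 * c + K + 2\<close>; the absolute value
      ensures \<open>K \<ge> 0\<close>.\<close>
    define K where "K = \<bar>r + r * L * norm y0 + g y0\<bar>"
    define c where "c = norm \<xi> + r * L"
    have "norm z \<le> 2 * c + K + 2" if z: "z \<in> G y0" for z
    proof -
      have zC: "z \<in> C" and le: "f y0 z + (g z - g y0) / r \<le> 0" using z by (auto simp: G_def h_def)
      have "L * norm (z - y0) \<le> L * (norm z + norm y0)"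
        using L(1) norm_triangle_ineq4[of z y0] by (intro mult_left_mono) auto
      hence "(g z - g y0) / r \<le> 1 + L * (norm z + norm y0)"
        using L(2)[OF zC] le refl[OF y0] by linarith
      hence "g z - g y0 \<le> r * (1 + L * (norm z + norm y0))"
        using r by (simp add: field_simps)
      moreover have "\<xi> z \<le> norm \<xi> * norm z" using norm_blinfun[of \<xi> z] by simp
      moreover have "r + r * L * norm y0 + g y0 \<le> K" unfolding K_def by (rule abs_ge_self)
      moreover have "g z = (norm z)\<^sup>2 / 2 - \<xi> z" by (simp add: g_def)
      ultimately have quad: "(norm z)\<^sup>2 / 2 \<le> c * norm z + K"
        unfolding c_def by (simp add: algebra_simps)
      show ?thesis
      proof (rule ccontr)
        define N where "N = norm z"
        assume "\<not> ?thesis"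
        hence n: "N > 2 * c + K + 2" by (simp add: N_def)
        have K: "K \<ge> 0" and c: "c \<ge> 0" using r L by (auto simp: K_def c_def)
        have "(2 * c + K + 2) * N \<le> N * N"
          using n K c by (intro mult_right_mono) auto
        moreover have "K * 2 \<le> K * N" using n K c by (intro mult_left_mono) auto
        moreover have "0 < N" using n K c by linarith
        moreover have "N * N / 2 \<le> c * N + K" using quad by (simp add: N_def power2_eq_square)
        ultimately show False by (simp add: algebra_simps)
      qed
    qed
    thus ?thesis unfolding bounded_iff by blast
  qed
  have "\<Inter>(G ` C) \<noteq> {}"
  proof (rule closed_convex_fip[OF \<kappa>])
    show "G y0 \<in> G ` C" using y0 by blast
  next
    fix X assume X: "finite X" "X \<noteq> {}" "X \<subseteq> G ` C"
    from finite_subset_image[OF X(1,3)] obtain I where I: "finite I" "I \<subseteq> C" "X = G ` I"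
      by (elim exE conjE)
    have "I \<noteq> {}" using X(2) I(3) by simp
    have h_mono: "h i j + h j i \<le> 0" if "i \<in> I" "j \<in> I" for i j
    proof -
      have "h i j + h j i = f i j + f j i" by (simp add: h_def diff_divide_distrib)
      with mono[of i j] that I(2) show ?thesis by (simp add: subset_iff)
    qed
    obtain \<mu> where \<mu>: "\<And>i. i \<in> I \<Longrightarrow> \<mu> i \<ge> 0" "sum \<mu> I = 1" "\<And>i. i \<in> I \<Longrightarrow> (\<Sum>j\<in>I. \<mu> j * h i j) \<le> 0"
      using nonpositive_payoff_strategy[OF I(1) \<open>I \<noteq> {}\<close>, where a = h] h_mono by blast
    define z where "z = (\<Sum>j\<in>I. \<mu> j *\<^sub>R j)"
    have "z \<in> C" unfolding z_def by (rule convex_sum[OF I(1) C(3) \<mu>(2)]) (use I \<mu>(1) in blast)+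
    moreover have "h i z \<le> 0" if i: "i \<in> I" for i
    proof -
      have "h i z \<le> (\<Sum>j\<in>I. \<mu> j * h i j)"
        unfolding z_def by (rule convex_on_sum[OF I(1) \<open>I \<noteq> {}\<close> h_convex \<mu>(2,1)]) (use I i in blast)+
      with \<mu>(3)[OF i] show ?thesis by simp
    qed
    ultimately have "z \<in> \<Inter>X" by (simp add: I(3) G_def)
    thus "\<Inter>X \<noteq> {}" by blast
  next
    fix H assume "H \<in> G ` C"
    then obtain y where "H = G y" "y \<in> C" by blast
    thus "closed H" "convex H" using closed convex_G by simp_all
  next
    show "bounded (G y0)" by (rule bounded)
  qed
  then obtain z where z: "z \<in> G y" if "y \<in> C" for y by blast
  show ?thesis
  proof (rule that)
    show "z \<in> C" using z[OF y0] by (simp add: G_def)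
    show "f y z + (g z - g y) / r \<le> 0" if "y \<in> C" for y using z[OF that] by (simp add: G_def h_def)
  qed
qed

text \<open>Two passages along segments: Minty's argument first reverses the arguments of
  \<open>f\<close>, with the potential \<open>g\<close> still in place; then the difference of
  \<open>g\<close> is replaced by its derivative, using continuity of \<open>J\<close>.\<close>

lemma resolvent_exists:
  fixes C :: "'a set" and \<xi> :: "'a \<Rightarrow>\<^sub>L real"
  assumes "equilibrium C f" and r: "r > 0"
  obtains z where "z \<in> C" "\<And>y. y \<in> C \<Longrightarrow> 0 \<le> f z y + 1 / r * (J z - \<xi>) (y - z)"
proof -
  interpret equilibrium C f by fact
  define g where "g z = (norm z)\<^sup>2 / 2 - \<xi> z" for z
  obtain z where z: "z \<in> C" "\<And>y. y \<in> C \<Longrightarrow> f y z + (g z - g y) / r \<le> 0"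
    unfolding g_def using minty_resolvent_exists[OF assms] by metis
  have g_convex: "convex_on C g" unfolding g_def by (rule convex_on_J_potential[OF C(3)])
  have g_lim: "((\<lambda>t. g (t *\<^sub>R y + (1 - t) *\<^sub>R z)) \<longlongrightarrow> g (0 *\<^sub>R y + (1 - 0) *\<^sub>R z)) (at_right 0)" for y
    unfolding g_def by (intro tendsto_intros) auto
  have potential: "0 \<le> f z y + (g y - g z) / r" if y: "y \<in> C" for y
  proof (rule hemi_limit[OF z(1) y y])
    have "((\<lambda>t. (g y - g (t *\<^sub>R y + (1 - t) *\<^sub>R z)) / r) \<longlongrightarrow> (g y - g (0 *\<^sub>R y + (1 - 0) *\<^sub>R z)) / r) (at_right 0)"
      by (intro tendsto_intros g_lim) (use r in auto)
    thus "((\<lambda>t. (g y - g (t *\<^sub>R y + (1 - t) *\<^sub>R z)) / r) \<longlongrightarrow> (g y - g z) / r) (at_right 0)" by simp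
  next
    fix t :: real assume t: "0 < t" "t < 1"
    let ?w = "t *\<^sub>R y + (1 - t) *\<^sub>R z"
    have w: "?w \<in> C" using z y t by (intro segment) auto
    have "0 \<le> t * f ?w y + (1 - t) * f ?w z"
      using f_segment_le[OF w z(1) y, of t] refl[OF w] t by simp
    moreover have "(1 - t) * (f ?w z + (g z - g ?w) / r) \<le> 0"
      using z(2)[OF w] t by (simp add: mult_nonneg_nonpos)
    moreover have "g ?w \<le> t * g y + (1 - t) * g z"
      using convex_onD[OF g_convex, of t z y] t z y by (simp add: add.commute)
    hence "g ?w / r \<le> (t * g y + (1 - t) * g z) / r" using r by (intro divide_right_mono) auto
    ultimately have "0 \<le> t * (f ?w y + (g y - g ?w) / r)"
      by (simp add: algebra_simps add_divide_distrib diff_divide_distrib)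
    thus "0 \<le> f ?w y + (g y - g ?w) / r" using t by (simp add: zero_le_mult_iff)
  qed
  have "0 \<le> f z y + 1 / r * (J z - \<xi>) (y - z)" if y: "y \<in> C" for y
  proof -
    let ?w = "\<lambda>t. t *\<^sub>R y + (1 - t) *\<^sub>R z"
    have "0 \<le> f z y + 1 / r * (J (?w t) - \<xi>) (y - z)" if t: "0 < t" "t < 1" for t
    proof -
      have w: "?w t \<in> C" using z y t by (intro segment) auto
      have eq: "z - ?w t = - (t *\<^sub>R (y - z))" by (simp add: algebra_simps)
      \<comment> \<open>\<open>J (?w t) - \<xi>\<close> is a subgradient of \<open>g\<close> at
        \<open>?w t\<close>; the resulting factor \<open>t\<close> cancels against the one from
        convexity of \<open>f z\<close>.\<close>
      have "g (?w t) - g z \<le> - (J (?w t) - \<xi>) (z - ?w t)"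
        using J_subgradient[of "?w t" z]
        by (simp add: g_def blinfun.diff_left blinfun.diff_right)
      also have "\<dots> = t * (J (?w t) - \<xi>) (y - z)"
        unfolding eq by (simp add: blinfun.minus_right blinfun.scaleR_right)
      finally have "(g (?w t) - g z) / r \<le> t * (J (?w t) - \<xi>) (y - z) / r"
        using r by (intro divide_right_mono) auto
      moreover have "0 \<le> f z (?w t) + (g (?w t) - g z) / r" by (rule potential[OF w])
      moreover have "f z (?w t) \<le> t * f z y"
        using f_segment_le[OF z(1) z(1) y, of t] refl[OF z(1)] t by simp
      ultimately have "0 \<le> t * (f z y + 1 / r * (J (?w t) - \<xi>) (y - z))"
        by (simp add: distrib_left)
      thus ?thesis using t by (simp add: zero_le_mult_iff)
    qed
    hence "\<forall>\<^sub>F t in at_right 0. 0 \<le> f z y + 1 / r * (J (?w t) - \<xi>) (y - z)"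
      unfolding eventually_at_right_field by (intro exI[of _ 1]) auto
    moreover have "((\<lambda>t. f z y + 1 / r * (J (?w t) - \<xi>) (y - z)) \<longlongrightarrow>
        f z y + 1 / r * (J (?w 0) - \<xi>) (y - z)) (at_right 0)"
      by (intro tendsto_intros)
    ultimately have "0 \<le> f z y + 1 / r * (J (?w 0) - \<xi>) (y - z)"
      by (intro tendsto_lowerbound) auto
    thus ?thesis by simp
  qed
  with z(1) show ?thesis using that by blast
qed

text \<open>For the zero bifunction on the whole space the resolvent inequality holds in opposite
  directions, so \<open>J z - \<xi>\<close> vanishes.\<close>

lemma J_J_inv [simp]: "J (J_inv \<xi> :: 'a) = \<xi>"
proof -
  have "equilibrium (UNIV :: 'a set) (\<lambda>_ _. 0)"
    by unfold_locales (auto simp: lsc_on_def Limsup_const convex_on_def intro: Liminf_bounded)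
  then obtain z :: 'a where z: "\<And>y. 0 \<le> (J z - \<xi>) (y - z)"
    using resolvent_exists[of UNIV "\<lambda>_ _. 0" 1 \<xi>] by auto
  have "(J z - \<xi>) y = 0" for y
    using z[of "z + y"] z[of "z - y"] by (simp add: blinfun.minus_right)
  hence "J z = \<xi>" by (intro blinfun_eqI) (simp add: blinfun.diff_left)
  thus ?thesis by (metis UNIV_I f_inv_into_f rangeI)
qed

end

section \<open>Projections, resolvents and gradient steps\<close>

lemma lsc_on_const: "lsc_on C (\<lambda>_. c)"
  unfolding lsc_on_def by (intro ballI Liminf_bounded) simp
lemma equilibrium_zero:
  fixes C :: "'a::real_normed_vector set"
  assumes "C \<noteq> {}" "closed C" "convex C"
  shows "equilibrium C (\<lambda>_ _. 0)"
  by unfold_locales (simp_all add: assms Limsup_const convex_on_const lsc_on_const)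

context smooth_convex_space
begin

text \<open>The inequality makes \<open>z\<close> a minimizer and gives any other minimizer
  \<open>w\<close> the value \<open>\<phi> w z \<le> 0\<close>, which settles the choice in
  \<open>arg_min_on\<close>.\<close>

lemma gen_proj_eqI:
  fixes z :: 'a
  assumes z: "z \<in> D" and le: "\<And>q. q \<in> D \<Longrightarrow> \<phi> q z + \<phi> z x \<le> \<phi> q x"
  shows "\<Pi> D x = z"
proof -
  have "is_arg_min (\<lambda>y. \<phi> y x) (\<lambda>y. y \<in> D) z"
    unfolding is_arg_min_linorder
  proof (intro conjI allI impI)
    fix q assume "q \<in> D"
    with le[of q] phi_nonneg[of q z] show "\<phi> z x \<le> \<phi> q x" by linarith
  qed (rule z)
  hence "is_arg_min (\<lambda>y. \<phi> y x) (\<lambda>y. y \<in> D) (\<Pi> D x)"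
    unfolding gen_proj_def arg_min_on_def arg_min_def by (rule someI)
  hence "\<Pi> D x \<in> D" "\<phi> (\<Pi> D x) x \<le> \<phi> z x"
    using z unfolding is_arg_min_linorder by blast+
  with le[of "\<Pi> D x"] have "\<phi> (\<Pi> D x) z \<le> 0" by linarith
  thus ?thesis by (rule phi_eq_0)
qed

lemma gen_proj:
  fixes D :: "'a set"
  assumes D: "D \<noteq> {}" "closed D" "convex D"
  shows "\<Pi> D x \<in> D" "q \<in> D \<Longrightarrow> 0 \<le> (J (\<Pi> D x) - J x) (q - \<Pi> D x)"
    and "q \<in> D \<Longrightarrow> \<phi> q (\<Pi> D x) + \<phi> (\<Pi> D x) x \<le> \<phi> q x"
proof -
  from equilibrium_zero[OF D] obtain z where zD: "z \<in> D"
    and "\<And>q. q \<in> D \<Longrightarrow> 0 \<le> 0 + 1 / 1 * (J z - J x) (q - z)"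
    by (rule resolvent_exists[OF _ zero_less_one, where \<xi> = "J x"]) (rule that)
  hence z: "0 \<le> (J z - J x) (q - z)" if "q \<in> D" for q using that by simp
  have le: "\<phi> q z + \<phi> z x \<le> \<phi> q x" if "q \<in> D" for q
    using z[OF that] phi_three_point[of q x z] by simp
  have eq: "\<Pi> D x = z"
    using zD le by (rule gen_proj_eqI)
  show "\<Pi> D x \<in> D" "q \<in> D \<Longrightarrow> 0 \<le> (J (\<Pi> D x) - J x) (q - \<Pi> D x)"
    "q \<in> D \<Longrightarrow> \<phi> q (\<Pi> D x) + \<phi> (\<Pi> D x) x \<le> \<phi> q x"
    unfolding eq using zD z le by blast+
qed

text \<open>For uniqueness, the inequalities of two candidates are added, each tested at the other:
  \<open>f\<close> drops out by (A2), and monotonicity of \<open>J\<close> makes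
  \<open>\<phi>\<close> vanish between them.\<close>

lemma resolvent:
  assumes "equilibrium C f" and r: "r > 0"
  shows "resolvent C f r x \<in> (C :: 'a set)"
    and "y \<in> C \<Longrightarrow> 0 \<le> f (resolvent C f r x) y + 1 / r * (J (resolvent C f r x) - J x) (y - resolvent C f r x)"
proof -
  interpret equilibrium C f by fact
  let ?P = "\<lambda>z. z \<in> C \<and> (\<forall>y\<in>C. f z y + 1 / r * (J z - J x) (y - z) \<ge> 0)"
  obtain z where z: "?P z"
    by (rule resolvent_exists[OF assms, of "J x"]) blast
  have "w = z" if w: "?P w" for w
  proof -
    have "0 \<le> f z w + 1 / r * (J z - J x) (w - z)" "0 \<le> f w z + 1 / r * (J w - J x) (z - w)"
      using z w by blast+
    moreover have "f z w + f w z \<le> 0" using z w mono by blast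
    moreover have "(J z - J x) (w - z) + (J w - J x) (z - w) = - (J w - J z) (w - z)"
      by (simp add: blinfun.diff_left blinfun.diff_right)
    hence "1 / r * (J z - J x) (w - z) + 1 / r * (J w - J x) (z - w) = - (1 / r * (J w - J z) (w - z))"
      by (simp flip: add_divide_distrib)
    ultimately have "1 / r * (J w - J z) (w - z) \<le> 0" by linarith
    hence "\<phi> w z + \<phi> z w \<le> 0"
      unfolding phi_add_swap using r by (simp add: divide_le_0_iff)
    hence "\<phi> w z \<le> 0" using phi_nonneg[of z w] by linarith
    thus "w = z" by (rule phi_eq_0)
  qed
  with z have eq: "resolvent C f r x = z" unfolding resolvent_def by (intro the_equality)
  show "resolvent C f r x \<in> C"
    "y \<in> C \<Longrightarrow> 0 \<le> f (resolvent C f r x) y + 1 / r * (J (resolvent C f r x) - J x) (y - resolvent C f r x)"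
    unfolding eq using z by blast+
qed

text \<open>Testing the resolvent inequality at \<open>q\<close>, where (A2) gives
  \<open>f ?z q \<le> 0\<close>, leaves the cross term of the three-point identity
  nonnegative.\<close>

lemma phi_resolvent_le:
  assumes "equilibrium C f" and r: "r > 0" and q: "q \<in> EP C f"
  shows "\<phi> q (resolvent C f r x) \<le> \<phi> q (x :: 'a)"
proof -
  interpret equilibrium C f by fact
  let ?z = "resolvent C f r x"
  have z: "?z \<in> C" by (rule resolvent(1)[OF assms(1,2)])
  have qC: "q \<in> C" "f q ?z \<ge> 0" using q z by (auto simp: EP_def)
  have "0 \<le> f ?z q + 1 / r * (J ?z - J x) (q - ?z)" by (rule resolvent(2)[OF assms(1,2) qC(1)])
  moreover have "f ?z q + f q ?z \<le> 0" using z qC mono by blast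
  ultimately have "0 \<le> 1 / r * (J ?z - J x) (q - ?z)" using qC(2) by linarith
  hence "0 \<le> (J ?z - J x) (q - ?z)" using r by (simp add: zero_le_divide_iff)
  thus ?thesis using phi_three_point[of q x ?z] phi_nonneg[of ?z x] by simp
qed

text \<open>As a function of \<open>J w\<close>, \<open>\<phi> q w\<close> is affine plus the
  squared dual norm, hence convex.\<close>

lemma phi_J_inv_convex_comb:
  fixes q x y :: 'a
  assumes t: "0 \<le> t" "t \<le> 1"
  shows "\<phi> q (J_inv (t *\<^sub>R J x + (1 - t) *\<^sub>R J y)) \<le> t * \<phi> q x + (1 - t) * \<phi> q y"
proof -
  define w :: 'a where "w = J_inv (t *\<^sub>R J x + (1 - t) *\<^sub>R J y)"
  have Jw: "J w = t *\<^sub>R J x + (1 - t) *\<^sub>R J y" by (simp add: w_def)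
  have "norm w \<le> t * norm x + (1 - t) * norm y"
    using norm_triangle_ineq[of "t *\<^sub>R J x" "(1 - t) *\<^sub>R J y"] t J_props(2)[of w]
    by (simp add: Jw J_props)
  hence "(norm w)\<^sup>2 \<le> (t * norm x + (1 - t) * norm y)\<^sup>2"
    by (intro power_mono) auto
  also have "\<dots> = t * (norm x)\<^sup>2 + (1 - t) * (norm y)\<^sup>2 - t * (1 - t) * (norm x - norm y)\<^sup>2"
    by (simp add: power2_eq_square algebra_simps)
  also have "\<dots> \<le> t * (norm x)\<^sup>2 + (1 - t) * (norm y)\<^sup>2" using t by simp
  finally have "(norm w)\<^sup>2 \<le> t * (norm x)\<^sup>2 + (1 - t) * (norm y)\<^sup>2" .
  thus ?thesis unfolding w_def[symmetric]
    unfolding lyapunov_def Jw by (simp add: blinfun.add_left blinfun.scaleR_left) (simp add: algebra_simps)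
qed

lemma gradient_step_dist:
  fixes v :: 'a and \<xi> :: "'a \<Rightarrow>\<^sub>L real"
  defines "c \<equiv> two_uniform_convexity_c TYPE('a)"
  assumes l: "l \<ge> 0"
  shows "norm (v - J_inv (J v - l *\<^sub>R \<xi>)) \<le> 2 / c\<^sup>2 * l * norm \<xi>"
  using two_uniform_convexity_c(2)[of v "J_inv (J v - l *\<^sub>R \<xi>)"] l by (simp add: c_def mult.assoc)

text \<open>Projecting does not increase \<open>\<phi> p\<close>. The term
  \<open>A v (p - \<omega>)\<close> splits at \<open>v\<close>: inverse strong monotonicity and the
  bound on \<open>A v\<close> give the gain \<open>\<alpha>\<close>, while the displacement
  \<open>v - \<omega>\<close> loses at most \<open>2 * l / c\<^sup>2\<close>.\<close>

lemma phi_gradient_step: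
  fixes v p :: 'a
  defines "c \<equiv> two_uniform_convexity_c TYPE('a)"
  assumes C: "C \<noteq> {}" "closed C" "convex C" and v: "v \<in> C"
    and A: "inverse_strongly_monotone \<alpha> C A" and p: "p \<in> VI A C"
    and bound: "norm (A v) \<le> norm (A v - A p)" and l: "0 \<le> l" "l \<le> \<alpha> * c\<^sup>2 / 2"
  shows "\<phi> p (\<Pi> C (J_inv (J v - l *\<^sub>R A v))) \<le> \<phi> p v - 2 * l * (\<alpha> - 2 * l / c\<^sup>2) * (norm (A v))\<^sup>2"
proof -
  have c: "c > 0" unfolding c_def by (rule two_uniform_convexity_c)
  define \<omega> where "\<omega> = J_inv (J v - l *\<^sub>R A v)"
  have pC: "p \<in> C" and VI: "0 \<le> A p (v - p)" using p v by (auto simp: VI_def)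
  have \<alpha>: "\<alpha> \<ge> 0" using order_trans[OF l] c by (simp add: zero_le_mult_iff)
  have "\<phi> p (\<Pi> C \<omega>) \<le> \<phi> p \<omega>"
    using gen_proj(3)[OF C pC, of \<omega>] phi_nonneg[of "\<Pi> C \<omega>" \<omega>] by linarith
  moreover have "\<phi> p v = \<phi> p \<omega> + \<phi> \<omega> v - 2 * l * A v (p - v) - 2 * l * A v (v - \<omega>)"
    unfolding phi_three_point[of p v \<omega>]
    by (simp add: \<omega>_def blinfun.minus_left blinfun.diff_right blinfun.scaleR_left right_diff_distrib)
  moreover have "\<phi> \<omega> v \<ge> 0" by (rule phi_nonneg)
  moreover have "2 * l * A v (p - v) \<le> 2 * l * - (\<alpha> * (norm (A v))\<^sup>2)"
  proof (rule mult_left_mono)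
    have "(norm (A v))\<^sup>2 \<le> (norm (A v - A p))\<^sup>2" using bound by (intro power_mono) auto
    from mult_left_mono[OF this \<alpha>] have "\<alpha> * (norm (A v))\<^sup>2 \<le> \<alpha> * (norm (A v - A p))\<^sup>2" .
    also have "\<dots> \<le> (A v - A p) (v - p)"
      using A v pC by (simp add: inverse_strongly_monotone_def)
    finally show "A v (p - v) \<le> - (\<alpha> * (norm (A v))\<^sup>2)"
      using VI by (simp add: blinfun.diff_left blinfun.diff_right)
  qed (use l in simp)
  moreover have "2 * l * A v (v - \<omega>) \<le> 2 * l * (2 * l / c\<^sup>2 * (norm (A v))\<^sup>2)"
  proof (rule mult_left_mono)
    have "A v (v - \<omega>) \<le> norm (A v) * norm (v - \<omega>)" using norm_blinfun[of "A v" "v - \<omega>"] by simp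
    also have "\<dots> \<le> norm (A v) * (2 / c\<^sup>2 * l * norm (A v))"
      unfolding \<omega>_def c_def by (intro mult_left_mono gradient_step_dist l) auto
    finally show "A v (v - \<omega>) \<le> 2 * l / c\<^sup>2 * (norm (A v))\<^sup>2" by (simp add: power2_eq_square mult_ac)
  qed (use l in simp)
  moreover have "2 * l * (\<alpha> - 2 * l / c\<^sup>2) * (norm (A v))\<^sup>2
      = - (2 * l * - (\<alpha> * (norm (A v))\<^sup>2)) - 2 * l * (2 * l / c\<^sup>2 * (norm (A v))\<^sup>2)"
    by (simp add: algebra_simps)
  ultimately show ?thesis unfolding \<omega>_def[symmetric] by linarith
qed

text \<open>\<open>\<phi>\<close> from \<open>v n\<close> to the projection is at most the
  symmetrized \<open>\<phi>\<close> between \<open>v n\<close> and \<open>\<omega> n\<close>, a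
  product of two factors of order \<open>norm (\<xi> n)\<close>.\<close>

lemma gradient_step_tendsto:
  fixes v w :: "nat \<Rightarrow> 'a" and \<xi> :: "nat \<Rightarrow> 'a \<Rightarrow>\<^sub>L real"
  assumes C: "C \<noteq> {}" "closed C" "convex C" and v: "\<And>n. v n \<in> C"
    and l: "\<And>n. 0 \<le> l n" "\<And>n. l n \<le> b" and \<xi>: "\<xi> \<longlonglongrightarrow> 0"
  shows "(\<lambda>n. v n - \<Pi> C (J_inv (J (v n) - l n *\<^sub>R \<xi> n))) \<longlonglongrightarrow> 0"
proof (rule phi_tendsto_0)
  define c where "c = two_uniform_convexity_c TYPE('a)"
  define \<omega> where "\<omega> n = J_inv (J (v n) - l n *\<^sub>R \<xi> n)" for n
  define B where "B n = 2 * (b * norm (\<xi> n)) * (2 / c\<^sup>2 * b * norm (\<xi> n))" for n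
  have "\<phi> (v n) (\<Pi> C (\<omega> n)) \<le> B n" for n
  proof -
    have "\<phi> (v n) (\<Pi> C (\<omega> n)) \<le> \<phi> (v n) (\<omega> n)"
      using gen_proj(3)[OF C v, of n "\<omega> n"] phi_nonneg[of "\<Pi> C (\<omega> n)" "\<omega> n"] by linarith
    also have "\<dots> \<le> \<phi> (v n) (\<omega> n) + \<phi> (\<omega> n) (v n)" using phi_nonneg by simp
    also have "\<dots> \<le> 2 * (norm (l n *\<^sub>R \<xi> n) * norm (v n - \<omega> n))"
      using norm_blinfun[of "J (v n) - J (\<omega> n)" "v n - \<omega> n"]
      unfolding phi_add_swap by (simp add: \<omega>_def)
    also have "\<dots> \<le> 2 * ((b * norm (\<xi> n)) * (2 / c\<^sup>2 * b * norm (\<xi> n)))"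
    proof (intro mult_left_mono mult_mono)
      show "norm (l n *\<^sub>R \<xi> n) \<le> b * norm (\<xi> n)" using l[of n] by (simp add: mult_right_mono)
      have "norm (v n - \<omega> n) \<le> 2 / c\<^sup>2 * l n * norm (\<xi> n)"
        unfolding \<omega>_def c_def by (rule gradient_step_dist[OF l(1)])
      also have "\<dots> \<le> 2 / c\<^sup>2 * b * norm (\<xi> n)"
        using l by (intro mult_right_mono mult_left_mono) auto
      finally show "norm (v n - \<omega> n) \<le> 2 / c\<^sup>2 * b * norm (\<xi> n)" .
      show "0 \<le> b * norm (\<xi> n)" using order_trans[OF l] by simp
    qed auto
    finally show ?thesis by (simp add: B_def)
  qed
  hence le: "\<forall>\<^sub>F n in sequentially. \<phi> (v n) (\<Pi> C (\<omega> n)) \<le> B n" by simp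
  have "B \<longlonglongrightarrow> 2 * (b * norm (0 :: 'a \<Rightarrow>\<^sub>L real)) * (2 / c\<^sup>2 * b * norm (0 :: 'a \<Rightarrow>\<^sub>L real))"
    unfolding B_def[abs_def] by (intro tendsto_intros \<xi>)
  hence lim: "B \<longlonglongrightarrow> 0" by simp
  show "(\<lambda>n. \<phi> (v n) (\<Pi> C (J_inv (J (v n) - l n *\<^sub>R \<xi> n)))) \<longlonglongrightarrow> 0"
    unfolding \<omega>_def[symmetric]
    by (rule tendsto_sandwich[OF _ le tendsto_const lim]) (simp add: phi_nonneg)
qed

lemma closed_phi_le_phi: "closed {v :: 'a. \<phi> v p \<le> \<phi> v q}"
  unfolding lyapunov_def by (intro closed_Collect_le continuous_intros)

text \<open>The squared norm of \<open>v\<close> cancels, leaving one linear inequality in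
  \<open>v\<close>.\<close>

lemma convex_phi_le_phi: "convex {v :: 'a. \<phi> v p \<le> \<phi> v q}"
proof -
  have "{v. \<phi> v p \<le> \<phi> v q} = {v. (J q - J p) v \<le> ((norm q)\<^sup>2 - (norm p)\<^sup>2) / 2}"
    by (auto simp: lyapunov_def blinfun.diff_left field_simps)
  also have "\<dots> = blinfun_apply (J q - J p) -` {..((norm q)\<^sup>2 - (norm p)\<^sup>2) / 2}" by auto
  also have "convex \<dots>"
    by (intro convex_linear_vimage bounded_linear.linear blinfun.bounded_linear_right) simp
  finally show ?thesis .
qed

end

section \<open>Convergence of the iteration\<close>

text \<open>The selected index has the largest distance to \<open>x n\<close>, so its distance
  dominates all others.\<close>

lemma arg_max_tendsto:
  fixes w :: "nat \<Rightarrow> 'i \<Rightarrow> 'a::real_normed_vector"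
  assumes max: "\<And>n. is_arg_max (\<lambda>i. norm (w n i - x n)) (\<lambda>i. i \<in> I) (idx n)"
    and lim: "(\<lambda>n. w n (idx n) - x n) \<longlonglongrightarrow> 0" and x: "x \<longlonglongrightarrow> p" and i: "i \<in> I"
  shows "(\<lambda>n. w n i) \<longlonglongrightarrow> p"
proof -
  have "norm (w n i - x n) \<le> norm (w n (idx n) - x n)" for n
    using max[of n] i unfolding is_arg_max_linorder by blast
  hence "(\<lambda>n. w n i - x n) \<longlonglongrightarrow> 0"
    by (intro Lim_null_comparison[OF always_eventually tendsto_norm_zero[OF lim]] allI)
  from tendsto_add[OF this x] show ?thesis by simp
qed

text \<open>Bounding the pairing by the product of norms shows \<open>A\<close> to be Lipschitz on
  \<open>C\<close> with constant \<open>1 / \<alpha>\<close>.\<close>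

lemma inverse_strongly_monotone_tendsto:
  assumes A: "inverse_strongly_monotone \<alpha> C A" and \<alpha>: "\<alpha> > 0"
    and u: "\<And>n. u n \<in> C" "u \<longlonglongrightarrow> p" and p: "p \<in> C"
  shows "(\<lambda>n. A (u n)) \<longlonglongrightarrow> A p"
proof -
  have "norm (A (u n) - A p) \<le> 1 / \<alpha> * norm (u n - p)" for n
  proof (cases "A (u n) = A p")
    case False
    have "\<alpha> * (norm (A (u n) - A p))\<^sup>2 \<le> (A (u n) - A p) (u n - p)"
      using A u(1) p by (simp add: inverse_strongly_monotone_def)
    also have "\<dots> \<le> norm (A (u n) - A p) * norm (u n - p)"
      using norm_blinfun[of "A (u n) - A p" "u n - p"] by simp
    finally have "norm (A (u n) - A p) * (\<alpha> * norm (A (u n) - A p)) \<le> norm (A (u n) - A p) * norm (u n - p)"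
      by (simp add: power2_eq_square mult_ac)
    hence "\<alpha> * norm (A (u n) - A p) \<le> norm (u n - p)"
      using False by (subst (asm) mult_le_cancel_left_pos) auto
    thus ?thesis using \<alpha> by (simp add: field_simps)
  qed (use \<alpha> in simp)
  hence "\<forall>\<^sub>F n in sequentially. norm (A (u n) - A p) \<le> 1 / \<alpha> * norm (u n - p)" by simp
  moreover have "(\<lambda>n. 1 / \<alpha> * norm (u n - p)) \<longlonglongrightarrow> 0"
    using u(2) by (intro tendsto_mult_right_zero tendsto_norm_zero) (simp only: LIM_zero_iff)
  ultimately have "(\<lambda>n. A (u n) - A p) \<longlonglongrightarrow> 0" by (rule Lim_null_comparison)
  thus ?thesis by (simp only: LIM_zero_iff)
qed

theorem theorem3p3:
  fixes C :: "'a::banach set"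
    and M N K :: nat
    and A :: "nat \<Rightarrow> 'a \<Rightarrow> 'a \<Rightarrow>\<^sub>L real"
    and f :: "nat \<Rightarrow> 'a \<Rightarrow> 'a \<Rightarrow> real"
    and S :: "nat \<Rightarrow> 'a \<Rightarrow> 'a"
    and F :: "'a set"
    and \<alpha> a b c d :: real
    and \<alpha>s lam r :: "nat \<Rightarrow> real"
    and x :: "nat \<Rightarrow> 'a"
    and y z u :: "nat \<Rightarrow> nat \<Rightarrow> 'a"
    and ybar zbar ubar :: "nat \<Rightarrow> 'a"
    and i_idx j_idx k_idx :: "nat \<Rightarrow> nat"
    and Cs :: "nat \<Rightarrow> 'a set"
  assumes E_smooth: "uniformly_smooth TYPE('a)"
    and E_convex: "two_uniformly_convex TYPE('a)"
    and C: "C \<noteq> {}" "closed C" "convex C"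
    and \<alpha>_pos: "\<alpha> > 0"
    and V1: "\<And>i. i \<in> {1..M} \<Longrightarrow> inverse_strongly_monotone \<alpha> C (A i)"
    and V2: "\<And>i. i \<in> {1..M} \<Longrightarrow> VI (A i) C \<noteq> {}"
    and V3: "\<And>i p q. i \<in> {1..M} \<Longrightarrow> p \<in> C \<Longrightarrow> q \<in> VI (A i) C \<Longrightarrow>
               norm (A i p) \<le> norm (A i p - A i q)"
    and A1: "\<And>k p. k \<in> {1..K} \<Longrightarrow> p \<in> C \<Longrightarrow> f k p p = 0"
    and A2: "\<And>k p q. k \<in> {1..K} \<Longrightarrow> p \<in> C \<Longrightarrow> q \<in> C \<Longrightarrow> f k p q + f k q p \<le> 0"
    and A3: "\<And>k p q v. k \<in> {1..K} \<Longrightarrow> p \<in> C \<Longrightarrow> q \<in> C \<Longrightarrow> v \<in> C \<Longrightarrow>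
               Limsup (at_right 0) (\<lambda>t::real. ereal (f k (t *\<^sub>R v + (1 - t) *\<^sub>R p) q))
                 \<le> ereal (f k p q)"
    and A4: "\<And>k p. k \<in> {1..K} \<Longrightarrow> p \<in> C \<Longrightarrow> convex_on C (f k p) \<and> lsc_on C (f k p)"
    and S_map: "\<And>j. j \<in> {1..N} \<Longrightarrow> S j \<in> C \<rightarrow> C"
    and S_closed: "\<And>j. j \<in> {1..N} \<Longrightarrow> closed_mapping C (S j)"
    and S_nonexp: "\<And>j. j \<in> {1..N} \<Longrightarrow> quasi_phi_nonexpansive C (S j)"
    and F: "F = (\<Inter>i\<in>{1..M}. VI (A i) C) \<inter> (\<Inter>j\<in>{1..N}. Fix C (S j)) \<inter> (\<Inter>k\<in>{1..K}. EP C (f k))"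
    and F_nonempty: "F \<noteq> {}"
    and \<alpha>s: "\<And>n. 0 \<le> \<alpha>s n \<and> \<alpha>s n \<le> 1" "limsup (\<lambda>n. ereal (\<alpha>s n)) < 1"
    and c: "c = two_uniform_convexity_c TYPE('a)"
    and ab: "a \<in> {0<..<\<alpha> * c\<^sup>2 / 2}" "b \<in> {0<..<\<alpha> * c\<^sup>2 / 2}"
    and lam: "\<And>n. lam n \<in> {a..b}"
    and d: "d > 0"
    and r: "\<And>n. r n \<ge> d"
    and x0: "x 0 \<in> C"
    and Cs0: "Cs 0 = C"
    and y: "\<And>n i. i \<in> {1..M} \<Longrightarrow> y n i = \<Pi> C (J_inv (J (x n) - lam n *\<^sub>R A i (x n)))"
    and i_idx: "\<And>n. is_arg_max (\<lambda>i. norm (y n i - x n)) (\<lambda>i. i \<in> {1..M}) (i_idx n)"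
    and ybar: "\<And>n. ybar n = y n (i_idx n)"
    and z: "\<And>n j. j \<in> {1..N} \<Longrightarrow>
              z n j = J_inv (\<alpha>s n *\<^sub>R J (x n) + (1 - \<alpha>s n) *\<^sub>R J (S j (ybar n)))"
    and j_idx: "\<And>n. is_arg_max (\<lambda>j. norm (z n j - x n)) (\<lambda>j. j \<in> {1..N}) (j_idx n)"
    and zbar: "\<And>n. zbar n = z n (j_idx n)"
    and u: "\<And>n k. k \<in> {1..K} \<Longrightarrow> u n k = resolvent C (f k) (r n) (zbar n)"
    and k_idx: "\<And>n. is_arg_max (\<lambda>k. norm (u n k - x n)) (\<lambda>k. k \<in> {1..K}) (k_idx n)"
    and ubar: "\<And>n. ubar n = u n (k_idx n)"
    and Cs_Suc: "\<And>n. Cs (Suc n) = {v \<in> Cs n. \<phi> v (ubar n) \<le> \<phi> v (zbar n) \<and> \<phi> v (zbar n) \<le> \<phi> v (x n)}"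
    and x_Suc: "\<And>n. x (Suc n) = \<Pi> (Cs (Suc n)) (x 0)"
  shows "x \<longlonglongrightarrow> \<Pi> F (x 0)"
proof -
  interpret smooth_convex_space "TYPE('a)"
    by unfold_locales (fact E_smooth E_convex)+
  have c_pos: "c > 0" unfolding c by (rule two_uniform_convexity_c)
  \<comment> \<open>An arg max belongs to its index set, so all three index sets are
    nonempty.\<close>
  have idx: "i_idx n \<in> {1..M}" "j_idx n \<in> {1..N}" "k_idx n \<in> {1..K}" for n
    using i_idx[of n] j_idx[of n] k_idx[of n] unfolding is_arg_max_def by blast+
  have eq: "equilibrium C (f k)" if "k \<in> {1..K}" for k
    by (rule equilibrium.intro) (use C A1[OF that] A2[OF that] A3[OF that] A4[OF that] in blast)+
  have lam': "0 \<le> lam n" "a \<le> lam n" "lam n \<le> b" "lam n \<le> \<alpha> * c\<^sup>2 / 2" for n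
    using lam[of n] ab by auto
  have r_pos: "r n > 0" for n using r[of n] d by linarith
  have yC: "y n i \<in> C" if "i \<in> {1..M}" for n i
    unfolding y[OF that] by (rule gen_proj(1)[OF C])
  have ybarC: "ybar n \<in> C" for n unfolding ybar by (rule yC[OF idx(1)])
  have uC: "u n k \<in> C" if "k \<in> {1..K}" for n k
    unfolding u[OF that] by (rule resolvent(1)[OF eq[OF that] r_pos])
  \<comment> \<open>\<open>q \<in> C\<close> is read off from one of the sets
    \<open>VI (A i) C\<close>; an index exists by \<open>idx\<close>.\<close>
  have FD: "q \<in> C" "i \<in> {1..M} \<Longrightarrow> q \<in> VI (A i) C" "j \<in> {1..N} \<Longrightarrow> q \<in> Fix C (S j)"
    "k \<in> {1..K} \<Longrightarrow> q \<in> EP C (f k)" if "q \<in> F" for q i j k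
    using that idx(1)[of 0] unfolding F VI_def by blast+

  \<comment> \<open>Decrease of \<open>\<phi> q\<close> in one iteration\<close>
  define \<theta> where "\<theta> = 2 * a * (\<alpha> - 2 * b / c\<^sup>2)"
  have b_c: "2 * b / c\<^sup>2 < \<alpha>" using ab c_pos by (simp add: field_simps)
  hence \<theta>: "\<theta> > 0" using ab by (simp add: \<theta>_def)
  define nA where "nA n = norm (A (i_idx n) (x n))" for n
  have phi_ybar: "\<phi> q (ybar n) \<le> \<phi> q (x n) - \<theta> * (nA n)\<^sup>2" if q: "q \<in> F" and xC: "x n \<in> C" for q n
  proof -
    have qVI: "q \<in> VI (A (i_idx n)) C" by (rule FD(2)[OF q idx(1)])
    \<comment> \<open>\<open>\<theta>\<close> is the gain coefficient at its worst over
      \<open>a \<le> lam n \<le> b\<close>, each factor bounded separately.\<close>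
    have "\<theta> \<le> 2 * lam n * (\<alpha> - 2 * lam n / c\<^sup>2)"
      unfolding \<theta>_def
    proof (intro mult_mono diff_left_mono divide_right_mono mult_left_mono)
      show "0 \<le> \<alpha> - 2 * b / c\<^sup>2" using b_c by simp
    qed (use lam'[of n] ab(1) in simp_all)
    hence "\<theta> * (nA n)\<^sup>2 \<le> 2 * lam n * (\<alpha> - 2 * lam n / c\<^sup>2) * (nA n)\<^sup>2"
      by (rule mult_right_mono) simp
    moreover have "\<phi> q (ybar n) \<le> \<phi> q (x n) - 2 * lam n * (\<alpha> - 2 * lam n / c\<^sup>2) * (nA n)\<^sup>2"
      unfolding ybar y[OF idx(1)] nA_def c
      by (rule phi_gradient_step[OF C xC V1[OF idx(1)] qVI V3[OF idx(1) xC qVI] lam'(1) lam'(4)[unfolded c]])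
    ultimately show ?thesis by linarith
  qed
  \<comment> \<open>Only the \<open>S\<close> part of the convex combination carries the gain, hence
    the factor \<open>1 - \<alpha>s n\<close>.\<close>
  have phi_zbar: "\<phi> q (zbar n) \<le> \<phi> q (x n) - (1 - \<alpha>s n) * (\<theta> * (nA n)\<^sup>2)" if q: "q \<in> F" and xC: "x n \<in> C" for q n
  proof -
    have "\<phi> q (S (j_idx n) (ybar n)) \<le> \<phi> q (ybar n)"
      using S_nonexp[OF idx(2)] FD(3)[OF q idx(2)] ybarC unfolding quasi_phi_nonexpansive_def by blast
    also have "\<dots> \<le> \<phi> q (x n) - \<theta> * (nA n)\<^sup>2" by (rule phi_ybar[OF q xC])
    finally have "(1 - \<alpha>s n) * \<phi> q (S (j_idx n) (ybar n)) \<le> (1 - \<alpha>s n) * (\<phi> q (x n) - \<theta> * (nA n)\<^sup>2)"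
      using \<alpha>s(1)[of n] by (intro mult_left_mono) auto
    moreover have "\<phi> q (zbar n) \<le> \<alpha>s n * \<phi> q (x n) + (1 - \<alpha>s n) * \<phi> q (S (j_idx n) (ybar n))"
      unfolding zbar z[OF idx(2)] using \<alpha>s(1)[of n] by (intro phi_J_inv_convex_comb) auto
    ultimately show ?thesis by (simp add: algebra_simps)
  qed
  have phi_ubar: "\<phi> q (ubar n) \<le> \<phi> q (zbar n)" if q: "q \<in> F" for q n
    unfolding ubar u[OF idx(3)] by (rule phi_resolvent_le[OF eq[OF idx(3)] r_pos FD(4)[OF q idx(3)]])

  \<comment> \<open>Invariants of the sets \<open>Cs n\<close>\<close>
  have invar: "closed (Cs n) \<and> convex (Cs n) \<and> F \<subseteq> Cs n \<and> Cs n \<subseteq> C \<and> x n \<in> Cs n" for n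
  proof (induction n)
    case 0
    show ?case using C x0 FD(1) unfolding Cs0 by blast
  next
    case (Suc n)
    have eq: "Cs (Suc n) = Cs n \<inter> {v. \<phi> v (ubar n) \<le> \<phi> v (zbar n)} \<inter> {v. \<phi> v (zbar n) \<le> \<phi> v (x n)}"
      unfolding Cs_Suc by blast
    have closed: "closed (Cs (Suc n))" "convex (Cs (Suc n))"
      unfolding eq using Suc by (intro closed_Int convex_Int closed_phi_le_phi convex_phi_le_phi; blast)+
    have F: "F \<subseteq> Cs (Suc n)"
    proof
      fix q assume q: "q \<in> F"
      have "0 \<le> (1 - \<alpha>s n) * (\<theta> * (nA n)\<^sup>2)" using \<alpha>s(1)[of n] \<theta> by simp
      \<comment> \<open>Needs \<open>x n \<in> C\<close>, which comes from the induction hypothesis;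
        hence one joint induction for all invariants.\<close>
      hence "\<phi> q (zbar n) \<le> \<phi> q (x n)" using phi_zbar[OF q, of n] Suc by force
      with phi_ubar[OF q, of n] Suc q show "q \<in> Cs (Suc n)" unfolding eq by blast
    qed
    hence "Cs (Suc n) \<noteq> {}" using F_nonempty by blast
    from gen_proj(1)[OF this closed] have "x (Suc n) \<in> Cs (Suc n)" unfolding x_Suc .
    moreover have "Cs (Suc n) \<subseteq> C" using Suc unfolding eq by blast
    ultimately show ?case using closed F by blast
  qed
  have Cs_closed: "closed (Cs n)" "convex (Cs n)" "F \<subseteq> Cs n" "x n \<in> Cs n" and xC: "x n \<in> C" for n
    using invar[of n] by blast+
  have Cs_ne: "Cs n \<noteq> {}" for n using Cs_closed(4)[of n] by blast
  have Cs_mono: "Cs n \<subseteq> Cs m" if "m \<le> n" for m n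
    using that by (rule lift_Suc_antimono_le[rotated]) (auto simp: Cs_Suc)
  \<comment> \<open>\<open>x 0\<close> is not introduced as a projection, but
    \<open>\<phi> (x 0) (x 0) = 0\<close> gives the case \<open>n = 0\<close>.\<close>
  have proj: "\<phi> q (x n) + \<phi> (x n) (x 0) \<le> \<phi> q (x 0)" if q: "q \<in> Cs n" for q n
  proof (cases n)
    case (Suc m)
    show ?thesis using gen_proj(3)[OF Cs_ne Cs_closed(1,2) q, of "x 0"] unfolding Suc x_Suc .
  qed simp
  have x_in: "x n \<in> Cs m" if "m \<le> n" for m n using Cs_mono[OF that] Cs_closed(4)[of n] by blast

  \<comment> \<open>The sequence \<open>x\<close> is Cauchy\<close>
  obtain p0 where p0: "p0 \<in> F" using F_nonempty by blast
  define e where "e n = \<phi> (x n) (x 0)" for n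
  have diff: "\<phi> (x n) (x m) \<le> e n - e m" if "m \<le> n" for m n
    using proj[OF x_in[OF that]] by (simp add: e_def)
  have "incseq e"
  proof (rule incseq_SucI)
    show "e n \<le> e (Suc n)" for n using diff[of n "Suc n"] phi_nonneg[of "x (Suc n)" "x n"] by simp
  qed
  moreover have "e n \<le> \<phi> p0 (x 0)" for n
  proof -
    have "p0 \<in> Cs n" using Cs_closed(3) p0 by blast
    from proj[OF this] phi_nonneg[of p0 "x n"] show ?thesis unfolding e_def by linarith
  qed
  ultimately obtain L where "e \<longlonglongrightarrow> L" using incseq_convergent by blast
  hence "Cauchy e" by (rule LIMSEQ_imp_Cauchy)
  have "Cauchy x"
  proof (rule CauchyI')
    obtain \<kappa> where \<kappa>: "\<kappa> > 0" "\<And>x y :: 'a. \<kappa> * (norm (x - y))\<^sup>2 \<le> \<phi> x y"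
      using phi_lower by blast
    fix \<epsilon> :: real assume \<epsilon>: "\<epsilon> > 0"
    hence "\<kappa> * \<epsilon>\<^sup>2 > 0" using \<kappa> by simp
    from metric_CauchyD[OF \<open>Cauchy e\<close> this] obtain n0 where
      n0: "\<And>m n. m \<ge> n0 \<Longrightarrow> n \<ge> n0 \<Longrightarrow> dist (e m) (e n) < \<kappa> * \<epsilon>\<^sup>2" by blast
    show "\<exists>n0. \<forall>m\<ge>n0. \<forall>n>m. dist (x m) (x n) < \<epsilon>"
    proof (intro exI allI impI)
      fix m n assume mn: "n0 \<le> m" "m < n"
      have "\<kappa> * (norm (x n - x m))\<^sup>2 \<le> e n - e m"
        using \<kappa>(2)[of "x n" "x m"] diff[of m n] mn by linarith
      also have "\<dots> < \<kappa> * \<epsilon>\<^sup>2" using n0[of n m] mn by (simp add: dist_real_def)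
      finally have "(norm (x n - x m))\<^sup>2 < \<epsilon>\<^sup>2" using \<kappa>(1) by simp
      thus "dist (x m) (x n) < \<epsilon>"
        unfolding dist_norm norm_minus_commute[of "x m"] by (rule power2_less_imp_less) (use \<epsilon> in simp)
    qed
  qed
  then obtain p where x_lim: "x \<longlonglongrightarrow> p" using Cauchy_convergent_iff convergentD by blast
  have pC: "p \<in> C" by (rule closed_sequentially[OF C(2) xC x_lim])
  have x_lim': "(\<lambda>n. x (Suc n)) \<longlonglongrightarrow> p" by (rule LIMSEQ_Suc[OF x_lim])

  \<comment> \<open>Limits of the auxiliary sequences\<close>
  have in_Suc: "\<phi> (x (Suc n)) (ubar n) \<le> \<phi> (x (Suc n)) (zbar n)"
    "\<phi> (x (Suc n)) (zbar n) \<le> \<phi> (x (Suc n)) (x n)" for n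
    using Cs_closed(4)[of "Suc n"] unfolding Cs_Suc by blast+
  have "(\<lambda>n. \<phi> (x (Suc n)) (x n)) \<longlonglongrightarrow> \<phi> p p" by (intro tendsto_phi x_lim x_lim')
  hence lim0: "(\<lambda>n. \<phi> (x (Suc n)) (x n)) \<longlonglongrightarrow> 0" by simp
  have close: "v \<longlonglongrightarrow> p" if v: "\<And>n. \<phi> (x (Suc n)) (v n) \<le> \<phi> (x (Suc n)) (x n)" for v
  proof -
    have "(\<lambda>n. \<phi> (x (Suc n)) (v n)) \<longlonglongrightarrow> 0"
      by (rule tendsto_sandwich[OF _ _ tendsto_const lim0]) (simp_all add: phi_nonneg v)
    from tendsto_diff[OF x_lim' phi_tendsto_0[OF this]] show ?thesis by simp
  qed
  have zbar_lim: "zbar \<longlonglongrightarrow> p" by (rule close) (rule in_Suc)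
  have ubar_lim: "ubar \<longlonglongrightarrow> p" by (rule close) (rule order_trans[OF in_Suc])
  have null: "(\<lambda>n. v n - x n) \<longlonglongrightarrow> 0" if "v \<longlonglongrightarrow> p" for v
    using tendsto_diff[OF that x_lim] by simp
  have z_lim: "(\<lambda>n. z n j) \<longlonglongrightarrow> p" if "j \<in> {1..N}" for j
    using j_idx null[OF zbar_lim, unfolded zbar] x_lim that by (rule arg_max_tendsto)
  have u_lim: "(\<lambda>n. u n k) \<longlonglongrightarrow> p" if "k \<in> {1..K}" for k
    using k_idx null[OF ubar_lim, unfolded ubar] x_lim that by (rule arg_max_tendsto)

  \<comment> \<open>A number strictly between the limit superior and \<open>1\<close>: eventually
    \<open>1 - \<alpha>s n\<close> exceeds the positive constant \<open>1 - \<rho>\<close>.\<close>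
  obtain \<rho> where \<rho>: "limsup (\<lambda>n. ereal (\<alpha>s n)) < ereal \<rho>" "ereal \<rho> < 1"
    using ereal_dense2[OF \<alpha>s(2)] by blast
  hence \<rho>1: "\<rho> < 1" by simp
  have ev: "\<forall>\<^sub>F n in sequentially. \<alpha>s n < \<rho>" using Limsup_lessD[OF \<rho>(1)] by simp

  have S_lim: "(\<lambda>n. S j (ybar n)) \<longlonglongrightarrow> p" if j: "j \<in> {1..N}" for j
  proof -
    let ?D = "\<lambda>n. J (S j (ybar n)) - J (x n)"
    have "(\<lambda>n. J (z n j) - J (x n)) \<longlonglongrightarrow> J p - J p"
      by (intro tendsto_diff tendsto_J z_lim j x_lim)
    hence "(\<lambda>n. 1 / (1 - \<rho>) * norm (J (z n j) - J (x n))) \<longlonglongrightarrow> 0"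
      by (intro tendsto_mult_right_zero tendsto_norm_zero) simp
    moreover from ev have "\<forall>\<^sub>F n in sequentially. norm (?D n) \<le> 1 / (1 - \<rho>) * norm (J (z n j) - J (x n))"
    proof eventually_elim
      case (elim n)
      \<comment> \<open>The combination defining \<open>z n j\<close> is affine under
        \<open>J\<close>, so the difference for \<open>S j\<close> is recovered by dividing by
        \<open>1 - \<alpha>s n\<close>.\<close>
      have "J (z n j) - J (x n) = (1 - \<alpha>s n) *\<^sub>R ?D n"
        by (simp add: z[OF j] algebra_simps)
      hence "norm (J (z n j) - J (x n)) = (1 - \<alpha>s n) * norm (?D n)" using \<alpha>s(1)[of n] by simp
      moreover have "(1 - \<rho>) * norm (?D n) \<le> (1 - \<alpha>s n) * norm (?D n)"
        using elim by (intro mult_right_mono) auto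
      ultimately show ?case using \<rho>1 by (simp add: field_simps)
    qed
    ultimately have "?D \<longlonglongrightarrow> 0" by (rule Lim_null_comparison[rotated])
    from tendsto_add[OF this tendsto_J[OF x_lim]] have "(\<lambda>n. J (S j (ybar n))) \<longlonglongrightarrow> J p" by simp
    thus ?thesis by (rule J_inverse_tendsto)
  qed

  have nA_lim: "nA \<longlonglongrightarrow> 0"
  proof -
    \<comment> \<open>\<open>phi_zbar\<close> at \<open>p0\<close>, solved for \<open>nA n\<close>;
      the numerator vanishes because \<open>x\<close> and \<open>zbar\<close> have the same
      limit.\<close>
    define B where "B n = sqrt ((\<phi> p0 (x n) - \<phi> p0 (zbar n)) / ((1 - \<rho>) * \<theta>))" for n
    have "(\<lambda>n. sqrt ((\<phi> p0 (x n) - \<phi> p0 (zbar n)) / ((1 - \<rho>) * \<theta>))) \<longlonglongrightarrow>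
        sqrt ((\<phi> p0 p - \<phi> p0 p) / ((1 - \<rho>) * \<theta>))"
      by (intro tendsto_real_sqrt tendsto_divide tendsto_diff tendsto_phi tendsto_const x_lim zbar_lim)
        (use \<rho>1 \<theta> in simp)
    hence "B \<longlonglongrightarrow> 0" by (simp add: B_def[abs_def])
    moreover from ev have "\<forall>\<^sub>F n in sequentially. norm (nA n) \<le> B n"
    proof eventually_elim
      case (elim n)
      have "(1 - \<rho>) * (\<theta> * (nA n)\<^sup>2) \<le> (1 - \<alpha>s n) * (\<theta> * (nA n)\<^sup>2)"
        using elim \<theta> by (intro mult_right_mono) auto
      also have "\<dots> \<le> \<phi> p0 (x n) - \<phi> p0 (zbar n)" using phi_zbar[OF p0 xC[of n]] by simp
      finally have "(nA n)\<^sup>2 \<le> (\<phi> p0 (x n) - \<phi> p0 (zbar n)) / ((1 - \<rho>) * \<theta>)"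
        using \<rho>1 \<theta> by (simp add: field_simps)
      thus ?case unfolding B_def by (simp add: nA_def real_le_rsqrt)
    qed
    ultimately show ?thesis by (rule Lim_null_comparison[rotated])
  qed
  hence "(\<lambda>n. A (i_idx n) (x n)) \<longlonglongrightarrow> 0"
    unfolding nA_def[abs_def] by (rule tendsto_norm_zero_cancel)
  \<comment> \<open>The index varies with \<open>n\<close>, so the lemma is applied to the sequence
    of functionals \<open>A (i_idx n) (x n)\<close>.\<close>
  from gradient_step_tendsto[OF C xC lam'(1,3) this]
  have "(\<lambda>n. x n - y n (i_idx n)) \<longlonglongrightarrow> 0" unfolding y[OF idx(1)] .
  from tendsto_minus[OF this] have ybar_null: "(\<lambda>n. y n (i_idx n) - x n) \<longlonglongrightarrow> 0" by simp
  have y_lim: "(\<lambda>n. y n i) \<longlonglongrightarrow> p" if "i \<in> {1..M}" for i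
    using i_idx ybar_null x_lim that by (rule arg_max_tendsto)
  have ybar_lim: "ybar \<longlonglongrightarrow> p"
    using tendsto_add[OF ybar_null x_lim] by (simp add: ybar[abs_def])

  \<comment> \<open>Membership of the limit in \<open>F\<close>\<close>
  have "p \<in> VI (A i) C" if i: "i \<in> {1..M}" for i
  proof -
    have "0 \<le> A i p (q - p)" if q: "q \<in> C" for q
    proof -
      let ?T = "\<lambda>n. (J (y n i) - J (x n)) (q - y n i)"
      have "?T \<longlonglongrightarrow> (J p - J p) (q - p)"
        by (intro blinfun.tendsto tendsto_diff tendsto_const tendsto_J y_lim i x_lim)
      hence T: "(\<lambda>n. - (1 / a * \<bar>?T n\<bar>)) \<longlonglongrightarrow> - 0"
        by (intro tendsto_minus tendsto_mult_right_zero tendsto_rabs_zero) simp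
      have lim: "(\<lambda>n. A i (x n) (q - y n i)) \<longlonglongrightarrow> A i p (q - p)"
        by (intro blinfun.tendsto tendsto_diff tendsto_const y_lim i
            inverse_strongly_monotone_tendsto[OF V1[OF i] \<alpha>_pos xC x_lim pC])
      \<comment> \<open>The variational inequality of the projection \<open>y n i\<close>, divided
        by \<open>lam n \<ge> a\<close>; the duality terms enter only through \<open>?T n\<close>,
        which tends to \<open>0\<close>.\<close>
      have "- (1 / a * \<bar>?T n\<bar>) \<le> A i (x n) (q - y n i)" for n
      proof -
        have "0 \<le> (J (y n i) - J (J_inv (J (x n) - lam n *\<^sub>R A i (x n)))) (q - y n i)"
          unfolding y[OF i] by (rule gen_proj(2)[OF C q])
        hence "0 \<le> ?T n + lam n * A i (x n) (q - y n i)"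
          by (simp add: blinfun.diff_left blinfun.scaleR_left)
        hence "- \<bar>?T n\<bar> \<le> lam n * A i (x n) (q - y n i)" by linarith
        hence "- (\<bar>?T n\<bar> / lam n) \<le> A i (x n) (q - y n i)"
          using lam'(2)[of n] ab by (simp add: field_simps)
        moreover have "\<bar>?T n\<bar> / lam n \<le> \<bar>?T n\<bar> / a"
          using lam'(2)[of n] ab by (intro divide_left_mono) auto
        ultimately show ?thesis by simp
      qed
      with LIMSEQ_le[OF T lim] show ?thesis by simp
    qed
    with pC show ?thesis by (simp add: VI_def)
  qed
  moreover have "p \<in> Fix C (S j)" if j: "j \<in> {1..N}" for j
    using S_closed[OF j, unfolded closed_mapping_def, rule_format, OF ybarC ybar_lim S_lim[OF j]] pC
    by (simp add: Fix_def)
  moreover have "p \<in> EP C (f k)" if k: "k \<in> {1..K}" for k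
  proof (rule equilibrium.EP_limit[OF eq[OF k] pC])
    fix q assume q: "q \<in> C"
    let ?T = "\<lambda>n. (J (u n k) - J (zbar n)) (q - u n k)"
    have "?T \<longlonglongrightarrow> (J p - J p) (q - p)"
      by (intro blinfun.tendsto tendsto_diff tendsto_const tendsto_J u_lim k zbar_lim)
    hence T: "(\<lambda>n. 1 / d * \<bar>?T n\<bar>) \<longlonglongrightarrow> 0"
      by (intro tendsto_mult_right_zero tendsto_rabs_zero) simp
    \<comment> \<open>(A2) exchanges the arguments, so that the moving point stands where
      \<open>f k\<close> is lower semicontinuous; \<open>r n \<ge> d\<close> bounds the
      remainder.\<close>
    have "f k q (u n k) \<le> 1 / d * \<bar>?T n\<bar>" for n
    proof -
      have "0 \<le> f k (u n k) q + 1 / r n * ?T n"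
        unfolding u[OF k] by (rule resolvent(2)[OF eq[OF k] r_pos q])
      moreover have "f k (u n k) q + f k q (u n k) \<le> 0" by (rule A2[OF k uC[OF k] q])
      moreover have "1 / r n * ?T n \<le> \<bar>?T n\<bar> / r n" using r_pos[of n] by (simp add: divide_right_mono)
      moreover have "\<bar>?T n\<bar> / r n \<le> \<bar>?T n\<bar> / d"
        using r[of n] d r_pos[of n] by (intro divide_left_mono) auto
      ultimately show ?thesis by simp
    qed
    thus "f k q p \<le> 0"
      by (rule lsc_on_lim_le[OF A4[OF k q, THEN conjunct2] pC u_lim[OF k] uC[OF k] T])
  qed
  ultimately have pF: "p \<in> F" unfolding F by blast

  \<comment> \<open>Identification of the limit\<close>
  have "\<Pi> F (x 0) = p"
  proof (rule gen_proj_eqI[OF pF])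
    fix q assume "q \<in> F"
    hence le: "\<phi> q (x n) + \<phi> (x n) (x 0) \<le> \<phi> q (x 0)" for n using proj Cs_closed(3) by blast
    have "(\<lambda>n. \<phi> q (x n) + \<phi> (x n) (x 0)) \<longlonglongrightarrow> \<phi> q p + \<phi> p (x 0)"
      by (intro tendsto_add tendsto_phi tendsto_const x_lim)
    thus "\<phi> q p + \<phi> p (x 0) \<le> \<phi> q (x 0)" by (rule LIMSEQ_le_const2) (use le in blast)
  qed
  with x_lim show ?thesis by simp
qed

end
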